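(* For parameters $t_1,\ldots,t_r$, $$\mathcal{Y}(z_1;t_1)\cdots\mathcal{Y}(z_r;t_r)=\prod_{1\le i<j\le r}F_{t_i,t_j}(z_j/z_i)\;:\!\mathcal{Y}(z_1;t_1)\cdots\mathcal{Y}(z_r;t_r)\!:\,,$$ where each factor $F_{t_i,t_j}(z_j/z_i)$ is expanded in nonnegative powers of $z_j/z_i$.
   Context: The parameters $t_1,\dots,t_r$ are elements of a field $\mathbb{K}$ of characteristic $0$ with $t_i^n\neq1$ for all odd $n\ge1$ (for instance independent indeterminates, with $\mathbb{K}=\mathbb{Q}(t_1,\ldots,t_r)$). Operators act on $\Gamma_{\mathbb{K}}=\mathbb{K}[p_1,p_3,p_5,\ldots]$. For odd $n\ge1$, $a_{-n}$ is multiplication by $p_n$ and $a_n=\frac n2\frac{\partial}{\partial p_n}$. For a parameter $t$ set $$A_t(z)=\sum_{n\ge1,\ n\text{ odd}}\frac{2(1-t^n)}{n}a_{-n}z^n,\qquad B_t(z)=-\sum_{n\ge1,\ n\text{ odd}}\frac{2}{n(1-t^n)}a_nz^{-n},$$ and $\mathcal{Y}(z;t)=e^{A_t(z)}e^{B_t(z)}$, a formal series in $z^{\pm1}$ with operator coefficients. The normally ordered product puts all $A$-parts to the left of all $B$-parts: $$:\!\mathcal{Y}(z_1;t_1)\cdots\mathcal{Y}(z_r;t_r)\!:\;=e^{A_{t_1}(z_1)+\cdots+A_{t_r}(z_r)}\,e^{B_{t_1}(z_1)+\cdots+B_{t_r}(z_r)}.$$ For parameters $t,s$, $$F_{t,s}(u)=\exp\Big(-2\sum_{n\ge1,\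 n\text{ odd}}\frac{1-s^n}{1-t^n}\frac{u^n}{n}\Big)\in\mathbb{K}[[u]].$$ *)

theory Defs
  imports "HOL-Library.Poly_Mapping" "HOL-Library.Groups_Big_Fun"
    "HOL-Computational_Algebra.Formal_Power_Series"
begin

text \<open>The polynomial ring \<open>K[p\<^sub>1, p\<^sub>3, p\<^sub>5, \<dots>]\<close>: polynomials are finitely supported functions on
  monomials, monomials are finitely supported exponent functions, and the index \<open>k\<close> stands for the
  variable \<open>p\<^bsub>2k+1\<^esub>\<close>.  Hence for odd \<open>n\<close> the variable \<open>p\<^sub>n\<close> has index \<open>n div 2\<close>.\<close>

type_synonym 'a Gamma = "(nat \<Rightarrow>\<^sub>0 nat) \<Rightarrow>\<^sub>0 'a"

definition scal :: "'a::field_char_0 \<Rightarrow> 'a Gamma \<Rightarrow> 'a Gamma" where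
  "scal c v = Poly_Mapping.single 0 c * v"

definition pvar :: "nat \<Rightarrow> 'a::field_char_0 Gamma" where
  "pvar n = Poly_Mapping.single (Poly_Mapping.single (n div 2) 1) 1"

text \<open>The partial derivative with respect to \<open>p\<^sub>n\<close>.  The truncated subtraction is harmless: if
  \<open>p\<^sub>n\<close> does not occur in the monomial \<open>m\<close>, the coefficient is zero.\<close>

definition pdiff :: "nat \<Rightarrow> 'a::field_char_0 Gamma \<Rightarrow> 'a Gamma" where
  "pdiff n v = (\<Sum>m\<in>Poly_Mapping.keys v.
     Poly_Mapping.single (m - Poly_Mapping.single (n div 2) 1)
       (of_nat (Poly_Mapping.lookup m (n div 2)) * Poly_Mapping.lookup v m))"

text \<open>The operators \<open>a\<^sub>k\<close>; only odd \<open>k\<close> are meaningful.\<close>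

definition heis :: "int \<Rightarrow> 'a::field_char_0 Gamma \<Rightarrow> 'a Gamma" where
  "heis k v = (if k < 0 then pvar (nat (- k)) * v
               else scal (of_int k / 2) (pdiff (nat k) v))"


text \<open>Formal series with operator coefficients, given by their coefficient functions.  The exponents
  form an abelian group: integers for series in \<open>z\<^sup>\<plusminus>\<^sup>1\<close>, finitely supported functions
  \<open>nat \<Rightarrow>\<^sub>0 int\<close> for series in \<open>z\<^sub>1\<^sup>\<plusminus>\<^sup>1, z\<^sub>2\<^sup>\<plusminus>\<^sup>1, \<dots>\<close>.  The sum defining a coefficient of a product or of
  an exponential has an infinite index set, but is taken after applying the coefficients to a
  polynomial \<open>v\<close>.  \<open>Sum_any\<close> is the sum over the support of the family and is
  zero by convention if that support is infinite.  This convention is never used below: the exponents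
  of each \<open>A\<close> (of each \<open>B\<close>) are positive (negative) multiples of unit vectors, the
  coefficients of \<open>exp(B)\<close> lower the degree of \<open>v\<close>, where \<open>p\<^sub>n\<close> has degree \<open>n\<close>, and the exponents
  of \<open>z\<^sub>j/z\<^sub>i\<close>, for \<open>i < j\<close>, generate a pointed cone, so all the supports are finite.\<close>

type_synonym ('e, 'a) op_series = "'e \<Rightarrow> 'a Gamma \<Rightarrow> 'a Gamma"

definition op_one :: "('e::ab_group_add, 'a::field_char_0) op_series" where
  "op_one e v = (if e = 0 then v else 0)"

definition op_times ::
    "('e::ab_group_add, 'a::field_char_0) op_series \<Rightarrow> ('e, 'a) op_series \<Rightarrow> ('e, 'a) op_series"
  where "op_times X Y e v = Sum_any (\<lambda>k. X k (Y (e - k) v))"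

definition op_power ::
    "('e::ab_group_add, 'a::field_char_0) op_series \<Rightarrow> nat \<Rightarrow> ('e, 'a) op_series" where
  "op_power X n = (op_times X ^^ n) op_one"

definition op_exp ::
    "('e::ab_group_add, 'a::field_char_0) op_series \<Rightarrow> ('e, 'a) op_series" where
  "op_exp X e v = Sum_any (\<lambda>n. scal (1 / fact n) (op_power X n e v))"

definition op_prod ::
    "('e::ab_group_add, 'a::field_char_0) op_series list \<Rightarrow> ('e, 'a) op_series" where
  "op_prod Xs = foldr op_times Xs op_one"


definition A_series :: "'a::field_char_0 \<Rightarrow> (int, 'a) op_series" where
  "A_series t k v =
     (if k > 0 \<and> odd k then scal (2 * (1 - t ^ nat k) / of_int k) (heis (- k) v) else 0)"

text \<open>The coefficient of \<open>z\<^sup>k\<close> with \<open>k = -n\<close>.\<close>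

definition B_series :: "'a::field_char_0 \<Rightarrow> (int, 'a) op_series" where
  "B_series t k v =
     (if k < 0 \<and> odd k
      then scal (- (2 / (of_int (- k) * (1 - t ^ nat (- k))))) (heis (- k) v) else 0)"

definition Y_series :: "'a::field_char_0 \<Rightarrow> (int, 'a) op_series" where
  "Y_series t = op_times (op_exp (A_series t)) (op_exp (B_series t))"

text \<open>The series \<open>X(z\<^sub>i)\<close> obtained from a series \<open>X(z)\<close> in one variable.\<close>

definition at_var ::
    "nat \<Rightarrow> (int, 'a::field_char_0) op_series \<Rightarrow> (nat \<Rightarrow>\<^sub>0 int, 'a) op_series" where
  "at_var i X e v =
     (if e = Poly_Mapping.single i (Poly_Mapping.lookup e i)
      then X (Poly_Mapping.lookup e i) v else 0)"

text \<open>The normally ordered product of \<open>Y(z\<^sub>1;t\<^sub>1), \<dots>, Y(z\<^sub>r;t\<^sub>r)\<close>.\<close>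

definition normal_Y :: "nat \<Rightarrow> (nat \<Rightarrow> 'a::field_char_0) \<Rightarrow> (nat \<Rightarrow>\<^sub>0 int, 'a) op_series" where
  "normal_Y r t =
     op_times (op_exp (\<lambda>e v. \<Sum>i=1..r. at_var i (A_series (t i)) e v))
              (op_exp (\<lambda>e v. \<Sum>i=1..r. at_var i (B_series (t i)) e v))"

definition F_fps :: "'a::field_char_0 \<Rightarrow> 'a \<Rightarrow> 'a fps" where
  "F_fps t s = fps_exp 1 oo
     (fps_const (- 2) *
      Abs_fps (\<lambda>n. if odd n then (1 - s ^ n) / (1 - t ^ n) * (1 / of_nat n) else 0))"

text \<open>For \<open>i \<noteq> j\<close>, the scalar series \<open>F(z\<^sub>j/z\<^sub>i)\<close> expanded in nonnegative powers of \<open>z\<^sub>j/z\<^sub>i\<close>, with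
  scalars acting on polynomials by multiplication.\<close>

definition at_ratio ::
    "nat \<Rightarrow> nat \<Rightarrow> 'a::field_char_0 fps \<Rightarrow> (nat \<Rightarrow>\<^sub>0 int, 'a) op_series" where
  "at_ratio j i F e v =
     (let n = Poly_Mapping.lookup e j in
      if n \<ge> 0 \<and> e = Poly_Mapping.single j n - Poly_Mapping.single i n
      then scal (fps_nth F (nat n)) v else 0)"

end

theory Submission
  imports Defs
begin

text \<open>Put \<open>\<alpha>(t,n) = 2 (1 - t\<^sup>n) / n\<close> and \<open>\<beta>(t,n) = 1 / (1 - t\<^sup>n)\<close>.  The Heisenberg relations
  \<open>[\<partial>\<^sub>n, p\<^sub>m] = \<delta>\<^bsub>nm\<^esub>\<close> give, for odd \<open>n\<close>, the commutators \<open>[\<partial>\<^sub>n, \<Y>(z;t)] = \<alpha>(t,n) z\<^sup>n \<Y>(z;t)\<close> and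
  \<open>[p\<^sub>n, \<Y>(z;t)] = \<beta>(t,n) z\<^bsup>-n\<^esup> \<Y>(z;t)\<close> with central factors.  Consequently both sides of the
  identity have the same commutators with all \<open>\<partial>\<^sub>n\<close> and all \<open>p\<^sub>n\<close>: the factors add up over the \<open>z\<^sub>i\<close>, and
  the scalars \<open>F(z\<^sub>j/z\<^sub>i)\<close> commute with everything.  A series with such commutators is determined by its
  vacuum expectation values, the constant terms of its coefficients applied to \<open>1\<close>: the
  variables generate the ring from \<open>1\<close>, and a polynomial is determined by the constant terms of its
  iterated derivatives (\<open>op_series_eqI\<close>).

  The vacuum expectation value of the right-hand side is \<open>\<Prod>F(z\<^sub>j/z\<^sub>i)\<close>.  That of
  the product \<open>\<Y>(z\<^sub>m;t\<^sub>m) \<dots> \<Y>(z\<^sub>r;t\<^sub>r)\<close> is computed by descending induction on \<open>m\<close>: the \<open>A\<close>-part of the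
  first factor vanishes against the dual vacuum, while the derivative of its \<open>B\<close>-part is a combination
  of the \<open>\<partial>\<^sub>n\<close>, whose commutators with the other factors are known.  This yields a
  first-order differential equation: applying \<open>z\<^sub>m \<partial>/\<partial>z\<^sub>m\<close> amounts to multiplying by
  \<open>\<Sum>\<^sub>j\<Sum>\<^sub>n 2 (1 - t\<^sub>j\<^sup>n) / (1 - t\<^sub>m\<^sup>n) (z\<^sub>j/z\<^sub>m)\<^sup>n\<close>, summed over \<open>j > m\<close> and odd \<open>n\<close> (\<open>euler_Ys\<close>).  By definition of \<open>F\<close>, the product of the
  \<open>F(z\<^sub>j/z\<^sub>m)\<close> satisfies the same equation (\<open>Fs_step\<close>), and both have the same coefficients at
  exponent \<open>0\<close> of \<open>z\<^sub>m\<close> (\<open>const_term_Ys_eq_Fs\<close>).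

  The coefficients of products and exponentials are finite sums: exponentials are controlled by
  a height function on exponents (\<open>exponentiable\<close>), and products need only be examined on the vacuum
  (\<open>composable_of_vacuum\<close>).\<close>

section \<open>The polynomial ring\<close>

lemma scal_add: "scal c (v + w) = scal c v + scal c w"
  by (simp add: scal_def distrib_left)

lemma scal_add_left: "scal (c + d) v = scal c v + scal d v"
  by (simp add: scal_def distrib_right single_add)

lemma scal_scal [simp]: "scal c (scal d v) = scal (c * d) v"
  by (simp add: scal_def mult_single flip: mult.assoc)

lemma scal_0 [simp]: "scal c 0 = 0"
  by (simp add: scal_def)

lemma scal_0_left [simp]: "scal 0 v = 0"
  by (simp add: scal_def)

lemma scal_1_left [simp]: "scal 1 v = v"
  by (simp add: scal_def)

lemma scal_mult_right: "v * scal c w = scal c (v * w)"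
  by (simp add: scal_def mult.left_commute)

lemma scal_sum: "scal c (sum f I) = (\<Sum>i\<in>I. scal c (f i))"
  by (simp add: scal_def sum_distrib_left)

lemma scal_sum_left: "scal (sum f I) v = (\<Sum>i\<in>I. scal (f i) v)"
  by (induction I rule: infinite_finite_induct) (simp_all add: scal_add_left)

lemma scal_minus_left: "scal (- c) v = - scal c v"
  by (simp add: scal_def single_uminus)

lemma scal_diff: "scal c (v - w) = scal c v - scal c w"
  by (simp add: scal_def right_diff_distrib)

lemma lookup_single_0_mult:
  fixes v :: "'a::field_char_0 Gamma"
  shows "Poly_Mapping.lookup (Poly_Mapping.single 0 c * v) m = c * Poly_Mapping.lookup v m"
proof -
  have "Poly_Mapping.single 0 c * v = Poly_Mapping.map ((*) c) v"
    by (simp add: mult_map_scale_conv_mult)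
  then show ?thesis
    by (simp add: Poly_Mapping.map.rep_eq when_def)
qed

lemma lookup_scal: "Poly_Mapping.lookup (scal c v) m = c * Poly_Mapping.lookup v m"
  by (simp add: scal_def lookup_single_0_mult)

lemma scal_single: "scal c (Poly_Mapping.single m d) = Poly_Mapping.single m (c * d)"
  by (simp add: scal_def mult_single)

lemma lookup_pdiff:
  "Poly_Mapping.lookup (pdiff n v) m =
     of_nat (Poly_Mapping.lookup m (n div 2) + 1) *
     Poly_Mapping.lookup v (m + Poly_Mapping.single (n div 2) 1)"
proof -
  let ?x = "Poly_Mapping.single (n div 2) (1::nat)"
  let ?f = "\<lambda>u. of_nat (Poly_Mapping.lookup u (n div 2)) * Poly_Mapping.lookup v u"
  have "Poly_Mapping.lookup (pdiff n v) m =
      (\<Sum>u\<in>Poly_Mapping.keys v. if u = m + ?x then ?f u else 0)"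
  proof -
    have "(?f u when u - ?x = m) = (if u = m + ?x then ?f u else 0)" for u
    proof (cases "Poly_Mapping.lookup u (n div 2) = 0")
      case True
      then show ?thesis by (auto simp: lookup_add)
    next
      case False
      have "u - ?x + ?x = u"
        by (rule poly_mapping_eqI) (use False in \<open>auto simp: lookup_add lookup_minus lookup_single when_def\<close>)
      then have "u - ?x = m \<longleftrightarrow> u = m + ?x"
        by (metis add_diff_cancel_right')
      then show ?thesis by (simp add: when_def)
    qed
    then show ?thesis
      by (simp add: pdiff_def lookup_sum lookup_single)
  qed
  also have "\<dots> = ?f (m + ?x)"
    by (simp add: sum.delta' in_keys_iff)
  finally show ?thesis
    by (simp add: lookup_add)
qed

lemma pdiff_add: "pdiff n (v + w) = pdiff n v + pdiff n w"
  by (rule poly_mapping_eqI) (simp add: lookup_pdiff lookup_add distrib_left)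

lemma pdiff_scal: "pdiff n (scal c v) = scal c (pdiff n v)"
  by (rule poly_mapping_eqI) (simp add: lookup_pdiff lookup_scal)

lemma pdiff_0 [simp]: "pdiff n 0 = 0"
  by (simp add: pdiff_def)

lemma pdiff_single:
  "pdiff n (Poly_Mapping.single m c) =
     Poly_Mapping.single (m - Poly_Mapping.single (n div 2) 1)
       (of_nat (Poly_Mapping.lookup m (n div 2)) * c)"
  by (simp add: pdiff_def)

lemma pdiff_1 [simp]: "pdiff n 1 = 0"
  by (simp add: pdiff_single flip: single_one)

lemma Gamma_induct_single [case_names single add]:
  fixes v :: "'a::field_char_0 Gamma"
  assumes "\<And>m c. P (Poly_Mapping.single m c)"
    and "\<And>v w. P v \<Longrightarrow> P w \<Longrightarrow> P (v + w)"
  shows "P v"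
proof -
  have "\<And>v. Poly_Mapping.keys v \<subseteq> K \<Longrightarrow> P v" if "finite K" for K
    using that
  proof (induction K rule: finite_induct)
    case empty
    then have "v = Poly_Mapping.single 0 0" by simp
    then show ?case using assms(1) by metis
  next
    case (insert m K)
    let ?s = "Poly_Mapping.single m (Poly_Mapping.lookup v m)"
    have "Poly_Mapping.keys (v - ?s) \<subseteq> K"
      using insert.prems by (auto simp: in_keys_iff lookup_minus lookup_single when_def split: if_splits)
    then have "P (v - ?s)" by (rule insert.IH)
    then have "P ((v - ?s) + ?s)" by (intro assms)
    then show ?case by simp
  qed
  then show ?thesis using finite_keys by blast
qed

text \<open>The Heisenberg relation between derivatives and multiplications.\<close>

lemma pdiff_pvar_mult:
  "pdiff n (pvar m * v) = pvar m * pdiff n v + (if n div 2 = m div 2 then v else 0)"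
proof (induction v rule: Gamma_induct_single)
  case (single u c)
  let ?x = "Poly_Mapping.single (n div 2) (1::nat)" and ?y = "Poly_Mapping.single (m div 2) (1::nat)"
  show ?case
  proof (cases "Poly_Mapping.lookup u (n div 2) = 0")
    case True
    then show ?thesis
      by (auto simp: pvar_def mult_single pdiff_single lookup_add lookup_single)
  next
    case False
    then have "u - ?x + ?x = u"
      by (intro poly_mapping_eqI) (auto simp: lookup_add lookup_minus lookup_single when_def)
    then have "?y + u - ?x = ?y + (u - ?x)"
      by (metis add.assoc add_diff_cancel_right')
    then show ?thesis
      by (auto simp: pvar_def mult_single pdiff_single lookup_add lookup_single distrib_right add_ac
          simp flip: single_add)
  qed
next
  case (add v w)
  then show ?case by (simp add: distrib_left pdiff_add)
qed

text \<open>Only odd \<open>n\<close> are needed in the last case: the variable with index \<open>k\<close> is \<open>pvar (2 * k + 1)\<close>.\<close>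

lemma Gamma_induct [case_names one scal add pvar]:
  fixes v :: "'a::field_char_0 Gamma"
  assumes one: "P 1"
    and scal: "\<And>c v. P v \<Longrightarrow> P (scal c v)"
    and add: "\<And>v w. P v \<Longrightarrow> P w \<Longrightarrow> P (v + w)"
    and pvar: "\<And>n v. odd n \<Longrightarrow> P v \<Longrightarrow> P (pvar n * v)"
  shows "P v"
proof (induction v rule: Gamma_induct_single)
  case (single m c)
  have pow: "P (Poly_Mapping.single (Poly_Mapping.single k n) 1 * v)" if "P v" for k n and v :: "'a Gamma"
  proof (induction n)
    case 0
    then show ?case using that by simp
  next
    case (Suc n)
    have "Poly_Mapping.single (Poly_Mapping.single k (Suc n)) (1::'a) =
        pvar (2 * k + 1) * Poly_Mapping.single (Poly_Mapping.single k n) 1"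
      by (simp add: pvar_def mult_single flip: Poly_Mapping.single_add)
    then show ?case
      using pvar[OF _ Suc, of "2 * k + 1"] by (simp add: mult.assoc)
  qed
  have "P (Poly_Mapping.single m 1)"
  proof (induction m rule: update_induct)
    case const
    then show ?case using one by simp
  next
    case (update f k n)
    have "Poly_Mapping.update k n f = Poly_Mapping.single k n + f"
      using update.hyps
      by (intro poly_mapping_eqI) (auto simp: lookup_update lookup_add lookup_single in_keys_iff)
    then show ?case
      using pow[OF update.IH, of k n] by (simp add: mult_single)
  qed
  then have "P (scal c (Poly_Mapping.single m 1))" by (rule scal)
  then show ?case by (simp add: scal_single)
next
  case (add v w)
  then show ?case by (rule assms(3))
qed

text \<open>The constant term of a polynomial, which pairs it with the dual vacuum vector.\<close>

abbreviation const_term :: "'a::field_char_0 Gamma \<Rightarrow> 'a" where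
  "const_term v \<equiv> Poly_Mapping.lookup v 0"

lemma const_term_pvar_mult [simp]: "const_term (pvar n * v) = 0"
proof (induction v rule: Gamma_induct_single)
  case (single m c)
  have "Poly_Mapping.single (n div 2) 1 + m \<noteq> 0"
  proof
    assume "Poly_Mapping.single (n div 2) 1 + m = 0"
    then have "Poly_Mapping.lookup (Poly_Mapping.single (n div 2) 1 + m) (n div 2) = 0" by simp
    then show False by (simp add: lookup_add)
  qed
  then show ?case by (simp add: pvar_def mult_single lookup_single)
qed (simp_all add: distrib_left lookup_add)

text \<open>If all derivatives of the members of a family are linear combinations of members, then
  every Taylor coefficient at the origin is a linear combination of constant terms.  So the family
  vanishes if its constant terms do.\<close>

lemma Gamma_family_eq_0:
  fixes f :: "'e \<Rightarrow> 'a::field_char_0 Gamma"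
  assumes const: "\<And>e. const_term (f e) = 0"
    and diff: "\<And>n e. odd n \<Longrightarrow> pdiff n (f e) = (\<Sum>i\<in>I n. scal (c n i) (f (g n i e)))"
  shows "f e = 0"
proof (rule poly_mapping_eqI)
  fix m
  have pow: "\<forall>e. Poly_Mapping.lookup (f e) (m + Poly_Mapping.single k n) = 0"
    if "\<And>e. Poly_Mapping.lookup (f e) m = 0" for m k n
  proof (induction n)
    case 0
    then show ?case using that by simp
  next
    case (Suc n)
    let ?m = "m + Poly_Mapping.single k n"
    have "of_nat (Poly_Mapping.lookup ?m k + 1) *
        Poly_Mapping.lookup (f e) (?m + Poly_Mapping.single k 1) = 0" for e
    proof -
      have "Poly_Mapping.lookup (pdiff (2 * k + 1) (f e)) ?m = 0"
        using Suc by (simp add: diff lookup_sum lookup_scal)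
      then show ?thesis by (simp only: lookup_pdiff) simp
    qed
    then have "Poly_Mapping.lookup (f e) (?m + Poly_Mapping.single k 1) = 0" for e
      by (metis Suc_eq_plus1 mult_eq_0_iff of_nat_eq_0_iff nat.distinct(1))
    then show ?case by (simp add: add.assoc flip: Poly_Mapping.single_add)
  qed
  have "\<forall>e. Poly_Mapping.lookup (f e) m = 0"
  proof (induction m rule: update_induct)
    case const
    then show ?case using assms(1) by simp
  next
    case (update u k n)
    have "Poly_Mapping.update k n u = u + Poly_Mapping.single k n"
      using update.hyps
      by (intro poly_mapping_eqI) (auto simp: lookup_update lookup_add lookup_single in_keys_iff)
    then show ?case using pow update.IH by simp
  qed
  then show "Poly_Mapping.lookup (f e) m = Poly_Mapping.lookup 0 m" by simp
qed

section \<open>Series with linear coefficients and their products\<close>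

text \<open>Linearity over the field of scalars, whose action on polynomials is \<open>scal\<close>.\<close>

definition linear_op :: "('a::field_char_0 Gamma \<Rightarrow> 'a Gamma) \<Rightarrow> bool" where
  "linear_op D \<longleftrightarrow> (\<forall>v w. D (v + w) = D v + D w) \<and> (\<forall>c v. D (scal c v) = scal c (D v))"

lemma linear_opI:
  assumes "\<And>v w. D (v + w) = D v + D w" and "\<And>c v. D (scal c v) = scal c (D v)"
  shows "linear_op D"
  using assms by (simp add: linear_op_def)

lemma linear_op_add: "linear_op D \<Longrightarrow> D (v + w) = D v + D w"
  and linear_op_scal: "linear_op D \<Longrightarrow> D (scal c v) = scal c (D v)"
  by (simp_all add: linear_op_def)

lemma linear_op_0: "linear_op D \<Longrightarrow> D 0 = 0"
  by (metis linear_op_scal scal_0_left)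

lemma linear_op_sum: "linear_op D \<Longrightarrow> D (sum f I) = (\<Sum>i\<in>I. D (f i))"
  by (induction I rule: infinite_finite_induct) (simp_all add: linear_op_0 linear_op_add)

lemma linear_op_scal_op: "linear_op D \<Longrightarrow> linear_op (\<lambda>v. scal c (D v))"
  by (simp add: linear_op_def scal_add mult.commute)

lemma linear_op_sum_op: "(\<And>i. i \<in> I \<Longrightarrow> linear_op (D i)) \<Longrightarrow> linear_op (\<lambda>v. \<Sum>i\<in>I. D i v)"
  by (simp add: linear_op_def scal_sum sum.distrib)

lemma linear_op_pdiff: "linear_op (pdiff n)"
  by (simp add: linear_op_def pdiff_add pdiff_scal)

lemma linear_op_pvar: "linear_op ((*) (pvar n))"
  by (simp add: linear_op_def distrib_left scal_mult_right)

text \<open>The condition under which each coefficient of the product of \<open>X\<close> and \<open>Y\<close>, applied to a polynomial, is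
  a finite sum.\<close>

definition composable :: "('e::ab_group_add, 'a::field_char_0) op_series \<Rightarrow> ('e, 'a) op_series \<Rightarrow> bool" where
  "composable X Y \<longleftrightarrow> (\<forall>e v. finite {k. X k \<noteq> (\<lambda>_. 0) \<and> Y (e - k) v \<noteq> 0})"

lemma op_times_eq_sum:
  assumes "\<And>k. linear_op (X k)" and "finite K"
    and "{k. X k \<noteq> (\<lambda>_. 0) \<and> Y (e - k) v \<noteq> 0} \<subseteq> K"
  shows "op_times X Y e v = (\<Sum>k\<in>K. X k (Y (e - k) v))"
  unfolding op_times_def
proof (rule Sum_any.expand_superset)
  show "{k. X k (Y (e - k) v) \<noteq> 0} \<subseteq> K"
  proof
    fix k assume "k \<in> {k. X k (Y (e - k) v) \<noteq> 0}"
    then have "X k \<noteq> (\<lambda>_. 0) \<and> Y (e - k) v \<noteq> 0"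
      using linear_op_0[OF assms(1)] by auto
    then show "k \<in> K" using assms(3) by auto
  qed
qed (use assms in auto)

lemma op_times_eq_0:
  assumes "\<And>k. linear_op (X k)" and "\<And>k. X k = (\<lambda>_. 0) \<or> Y (e - k) v = 0"
  shows "op_times X Y e v = 0"
  by (subst op_times_eq_sum[where K = "{}"]) (use assms in auto)

lemma linear_op_times:
  assumes X: "\<And>k. linear_op (X k)" and Y: "\<And>k. linear_op (Y k)" and XY: "composable X Y"
  shows "linear_op (op_times X Y e)"
proof -
  define S where "S v = {k. X k \<noteq> (\<lambda>_. 0) \<and> Y (e - k) v \<noteq> 0}" for v
  have fin: "finite (S v)" for v
    using XY by (simp add: S_def composable_def)
  have eq: "op_times X Y e v = (\<Sum>k\<in>K. X k (Y (e - k) v))" if "finite K" "S v \<subseteq> K" for v K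
    using op_times_eq_sum[OF X that(1)] that(2) by (simp add: S_def)
  show ?thesis
  proof (rule linear_opI)
    fix v w
    let ?K = "S v \<union> S w \<union> S (v + w)"
    show "op_times X Y e (v + w) = op_times X Y e v + op_times X Y e w"
      using fin by (subst (1 2 3) eq[of ?K])
        (auto simp: sum.distrib linear_op_add[OF X] linear_op_add[OF Y])
  next
    fix c v
    let ?K = "S v \<union> S (scal c v)"
    show "op_times X Y e (scal c v) = scal c (op_times X Y e v)"
      using fin by (subst (1 2) eq[of ?K])
        (auto simp: scal_sum linear_op_scal[OF X] linear_op_scal[OF Y])
  qed
qed

text \<open>The commutation relation \<open>[D, X] = (\<Sum>i\<in>I. c\<^sub>i z\<^bsup>s(i)\<^esup>) X\<close> between an operator \<open>D\<close> and a series \<open>X\<close>;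
  multiplication by \<open>z\<^sup>s\<close> shifts the coefficient functions by \<open>s\<close>.\<close>

definition shift_comm ::
    "('a::field_char_0 Gamma \<Rightarrow> 'a Gamma) \<Rightarrow> nat set \<Rightarrow> (nat \<Rightarrow> 'e::ab_group_add) \<Rightarrow> (nat \<Rightarrow> 'a) \<Rightarrow>
     ('e, 'a) op_series \<Rightarrow> bool" where
  "shift_comm D I s c X \<longleftrightarrow>
     (\<forall>e v. D (X e v) = X e (D v) + (\<Sum>i\<in>I. scal (c i) (X (e - s i) v)))"

lemma shift_commD:
  "shift_comm D I s c X \<Longrightarrow> D (X e v) = X e (D v) + (\<Sum>i\<in>I. scal (c i) (X (e - s i) v))"
  by (simp add: shift_comm_def)

text \<open>The factors \<open>\<Sum>i\<in>I. c\<^sub>i z\<^bsup>s(i)\<^esup>\<close> are central, so they add up in a product.\<close>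

lemma shift_comm_times:
  fixes X Y :: "('e::ab_group_add, 'a::field_char_0) op_series"
  assumes D: "linear_op D" and I: "finite I"
    and X: "\<And>k. linear_op (X k)" and Y: "\<And>k. linear_op (Y k)" and XY: "composable X Y"
    and cX: "shift_comm D I s c X" and dY: "shift_comm D I s d Y"
  shows "shift_comm D I s (\<lambda>i. c i + d i) (op_times X Y)"
  unfolding shift_comm_def
proof (intro allI)
  fix e v
  define S where "S e v = {k. X k \<noteq> (\<lambda>_. 0) \<and> Y (e - k) v \<noteq> 0}" for e v
  have fin: "finite (S e v)" for e v
    using XY by (simp add: S_def composable_def)
  have eq: "op_times X Y e v = (\<Sum>k\<in>K. X k (Y (e - k) v))" if "finite K" "S e v \<subseteq> K" for e v K
    using op_times_eq_sum[OF X that(1)] that(2) by (simp add: S_def)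
  \<comment> \<open>One finite index set for all the coefficients that occur, also after translation by \<open>s i\<close>.\<close>
  define K where "K = S e v \<union> S e (D v) \<union> (\<Union>i\<in>I. S (e - s i) v \<union> (+) (s i) ` S (e - s i) v)"
  have finK: "finite K" using I fin by (simp add: K_def)
  have shifted: "(\<Sum>k\<in>K. X (k - s i) (Y (e - k) v)) = op_times X Y (e - s i) v" if "i \<in> I" for i
  proof -
    have "S (e - s i) v \<subseteq> (\<lambda>k. k - s i) ` K"
    proof
      fix k assume "k \<in> S (e - s i) v"
      then have "s i + k \<in> K" using that by (auto simp: K_def)
      then show "k \<in> (\<lambda>k. k - s i) ` K" by (rule rev_image_eqI) simp
    qed
    then have "op_times X Y (e - s i) v = (\<Sum>k\<in>(\<lambda>k. k - s i) ` K. X k (Y (e - s i - k) v))"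
      using finK by (intro eq) auto
    also have "\<dots> = (\<Sum>k\<in>K. X (k - s i) (Y (e - k) v))"
      by (subst sum.reindex) (auto simp: inj_on_def)
    finally show ?thesis by simp
  qed
  have swap: "e - k - s i = e - s i - k" for i k by simp
  have "D (op_times X Y e v) = (\<Sum>k\<in>K. D (X k (Y (e - k) v)))"
    using finK by (subst eq[of K]) (auto simp: K_def linear_op_sum[OF D])
  also have "\<dots> = (\<Sum>k\<in>K. X k (Y (e - k) (D v)) +
      (\<Sum>i\<in>I. scal (d i) (X k (Y (e - s i - k) v))) + (\<Sum>i\<in>I. scal (c i) (X (k - s i) (Y (e - k) v))))"
    by (intro sum.cong refl)
      (simp add: shift_commD[OF cX] shift_commD[OF dY] linear_op_add[OF X] linear_op_sum[OF X]
        linear_op_scal[OF X] swap)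
  also have "\<dots> = (\<Sum>k\<in>K. X k (Y (e - k) (D v))) +
      (\<Sum>i\<in>I. scal (d i) (\<Sum>k\<in>K. X k (Y (e - s i - k) v))) +
      (\<Sum>i\<in>I. scal (c i) (\<Sum>k\<in>K. X (k - s i) (Y (e - k) v)))"
    by (simp add: sum.distrib scal_sum sum.swap[of _ I K])
  also have "(\<Sum>k\<in>K. X k (Y (e - k) (D v))) = op_times X Y e (D v)"
    using finK by (intro eq[symmetric]) (auto simp: K_def)
  also have "(\<Sum>i\<in>I. scal (d i) (\<Sum>k\<in>K. X k (Y (e - s i - k) v))) =
      (\<Sum>i\<in>I. scal (d i) (op_times X Y (e - s i) v))"
    using finK by (intro sum.cong refl arg_cong2[where f = scal] eq[symmetric]) (auto simp: K_def)
  also have "(\<Sum>i\<in>I. scal (c i) (\<Sum>k\<in>K. X (k - s i) (Y (e - k) v))) =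
      (\<Sum>i\<in>I. scal (c i) (op_times X Y (e - s i) v))"
    by (simp add: shifted)
  finally show "D (op_times X Y e v) =
      op_times X Y e (D v) + (\<Sum>i\<in>I. scal (c i + d i) (op_times X Y (e - s i) v))"
    by (simp add: scal_add_left sum.distrib add_ac)
qed

lemma linear_op_one: "linear_op (op_one e)"
  by (simp add: linear_op_def op_one_def)

lemma op_times_one_right:
  assumes X: "\<And>k. linear_op (X k)"
  shows "op_times X op_one = X"
proof (intro ext)
  fix e v
  have "op_times X op_one e v = (\<Sum>k\<in>{e}. X k (op_one (e - k) v))"
    by (rule op_times_eq_sum[OF X]) (auto simp: op_one_def)
  then show "op_times X op_one e v = X e v" by (simp add: op_one_def)
qed

section \<open>Exponentials of series\<close>

text \<open>A condition under which the exponential series of \<open>X\<close> has finite coefficient sums: all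
  exponents that occur in \<open>X\<close> have positive height for an additive height function, and only finitely
  many of them lie below any given height.\<close>

definition exponentiable ::
    "('e::ab_group_add \<Rightarrow> int) \<Rightarrow> ('e, 'a::field_char_0) op_series \<Rightarrow> bool" where
  "exponentiable h X \<longleftrightarrow> (\<forall>e. linear_op (X e)) \<and> (\<forall>e f. h (e + f) = h e + h f) \<and>
     (\<forall>e. X e \<noteq> (\<lambda>_. 0) \<longrightarrow> h e \<ge> 1) \<and> (\<forall>N. finite {e. X e \<noteq> (\<lambda>_. 0) \<and> h e \<le> N})"

context
  fixes h :: "'e::ab_group_add \<Rightarrow> int" and X :: "('e, 'a::field_char_0) op_series"
  assumes expable: "exponentiable h X"
begin

lemma exponentiable_linear: "linear_op (X e)"
  using expable by (simp add: exponentiable_def)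

lemma height_diff: "h (e - f) = h e - h f"
proof -
  have "h (e - f + f) = h (e - f) + h f"
    using expable unfolding exponentiable_def by blast
  then show ?thesis by simp
qed

lemma height_0: "h 0 = 0"
  using height_diff[of 0 0] by simp

lemma op_power_0: "op_power X 0 = op_one"
  and op_power_Suc: "op_power X (Suc n) = op_times X (op_power X n)"
  by (simp_all add: op_power_def)

lemma op_power_height: "op_power X n e v \<noteq> 0 \<Longrightarrow> int n \<le> h e"
proof (induction n arbitrary: e)
  case 0
  then show ?case by (auto simp: op_power_0 op_one_def height_0 split: if_splits)
next
  case (Suc n)
  obtain k where k: "X k \<noteq> (\<lambda>_. 0)" "op_power X n (e - k) v \<noteq> 0"
    using Suc.prems op_times_eq_0[of X "op_power X n" e v, OF exponentiable_linear]
    by (auto simp: op_power_Suc)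
  have "h k \<ge> 1" using expable k(1) by (auto simp: exponentiable_def)
  moreover have "int n \<le> h e - h k" using Suc.IH[OF k(2)] by (simp add: height_diff)
  ultimately show ?case by simp
qed

lemma composable_op_power: "composable X (op_power X n)"
  unfolding composable_def
proof (intro allI)
  fix e v
  have "{k. X k \<noteq> (\<lambda>_. 0) \<and> op_power X n (e - k) v \<noteq> 0} \<subseteq> {k. X k \<noteq> (\<lambda>_. 0) \<and> h k \<le> h e}"
    using op_power_height by (fastforce simp: height_diff)
  moreover have "finite {k. X k \<noteq> (\<lambda>_. 0) \<and> h k \<le> h e}"
    using expable by (simp add: exponentiable_def)
  ultimately show "finite {k. X k \<noteq> (\<lambda>_. 0) \<and> op_power X n (e - k) v \<noteq> 0}"
    by (rule finite_subset)
qed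

lemma linear_op_power: "linear_op (op_power X n e)"
proof (induction n arbitrary: e)
  case 0
  then show ?case by (simp add: op_power_0 linear_op_one)
next
  case (Suc n)
  then show ?case
    by (simp add: op_power_Suc linear_op_times exponentiable_linear composable_op_power)
qed

lemma op_exp_eq_sum:
  assumes "h e \<le> int M"
  shows "op_exp X e v = (\<Sum>n\<le>M. scal (1 / fact n) (op_power X n e v))"
  unfolding op_exp_def
proof (rule Sum_any.expand_superset)
  show "{n. scal (1 / fact n) (op_power X n e v) \<noteq> 0} \<subseteq> {..M}"
  proof
    fix n assume "n \<in> {n. scal (1 / fact n) (op_power X n e v) \<noteq> 0}"
    then have "op_power X n e v \<noteq> 0" by auto
    then show "n \<in> {..M}" using op_power_height assms by fastforce
  qed
qed simp

lemma op_exp_height_neg: "h e < 0 \<Longrightarrow> op_exp X e v = 0"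
  using op_exp_eq_sum[of e 0 v] op_power_height[of 0 e v] by auto

lemma op_exp_height_0: "h e = 0 \<Longrightarrow> op_exp X e v = op_one e v"
  using op_exp_eq_sum[of e 0 v] by (simp add: op_power_0)

lemma linear_op_exp: "linear_op (op_exp X e)"
proof -
  have "op_exp X e = (\<lambda>v. \<Sum>n\<le>nat (h e). scal (1 / fact n) (op_power X n e v))"
    by (rule ext, rule op_exp_eq_sum) simp
  then show ?thesis
    by (simp add: linear_op_sum_op linear_op_scal_op linear_op_power)
qed

lemma op_power_support:
  assumes C: "0 \<in> C" "\<And>e f. e \<in> C \<Longrightarrow> f \<in> C \<Longrightarrow> e + f \<in> C"
    and X: "\<And>e. X e \<noteq> (\<lambda>_. 0) \<Longrightarrow> e \<in> C"
  shows "op_power X n e v \<noteq> 0 \<Longrightarrow> e \<in> C"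
proof (induction n arbitrary: e)
  case 0
  then show ?case using C by (auto simp: op_power_0 op_one_def split: if_splits)
next
  case (Suc n)
  obtain k where k: "X k \<noteq> (\<lambda>_. 0)" "op_power X n (e - k) v \<noteq> 0"
    using Suc.prems op_times_eq_0[of X "op_power X n" e v, OF exponentiable_linear]
    by (auto simp: op_power_Suc)
  have "k + (e - k) \<in> C" by (intro C X Suc.IH k)
  then show ?case by simp
qed

lemma op_exp_support:
  assumes C: "0 \<in> C" "\<And>e f. e \<in> C \<Longrightarrow> f \<in> C \<Longrightarrow> e + f \<in> C"
    and X: "\<And>e. X e \<noteq> (\<lambda>_. 0) \<Longrightarrow> e \<in> C"
    and nz: "op_exp X e v \<noteq> 0"
  shows "e \<in> C"
proof -
  have "op_exp X e v = (\<Sum>n\<le>nat (h e). scal (1 / fact n) (op_power X n e v))"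
    by (rule op_exp_eq_sum) simp
  then obtain n where "op_power X n e v \<noteq> 0"
    using nz by (metis (no_types, lifting) scal_0 sum.neutral)
  then show ?thesis using op_power_support C X by blast
qed

text \<open>If all the coefficients of \<open>X\<close> annihilate \<open>v\<close>, then the exponential of \<open>X\<close> fixes \<open>v\<close>.  The next lemma
  is the dual statement for the functional that takes constant terms.\<close>

lemma op_exp_vacuum:
  assumes "\<And>e. X e v = 0"
  shows "op_exp X e v = op_one e v"
proof -
  have 1: "op_power X (Suc n) e v = 0" for n e
  proof (induction n arbitrary: e)
    case 0
    then show ?case
      by (simp add: op_power_Suc op_power_0 op_times_one_right[OF exponentiable_linear] assms)
  next
    case (Suc n)
    then show ?case
      by (subst op_power_Suc) (auto intro!: op_times_eq_0 exponentiable_linear)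
  qed
  then have 2: "op_power X n e v = 0" if "n \<noteq> 0" for n
    using that by (cases n) auto
  have "op_exp X e v = (\<Sum>n\<le>nat (h e). scal (1 / fact n) (op_power X n e v))"
    by (rule op_exp_eq_sum) simp
  also have "\<dots> = (\<Sum>n\<in>{0}. scal (1 / fact n) (op_power X n e v))"
    by (rule sum.mono_neutral_right) (auto simp: 2)
  finally show ?thesis by (simp add: op_power_0)
qed

lemma op_exp_covacuum:
  assumes "\<And>e v. const_term (X e v) = 0"
  shows "const_term (op_exp X e v) = const_term (op_one e v)"
proof -
  have 1: "const_term (op_power X n e v) = 0" if "n \<noteq> 0" for n
  proof -
    obtain n' where "n = Suc n'" using \<open>n \<noteq> 0\<close> not0_implies_Suc by blast
    moreover have "const_term (op_times X (op_power X n') e v) = 0"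
    proof -
      let ?K = "{k. X k \<noteq> (\<lambda>_. 0) \<and> op_power X n' (e - k) v \<noteq> 0}"
      have "op_times X (op_power X n') e v = (\<Sum>k\<in>?K. X k (op_power X n' (e - k) v))"
        using composable_op_power by (intro op_times_eq_sum exponentiable_linear) (auto simp: composable_def)
      then show ?thesis by (simp add: lookup_sum assms)
    qed
    ultimately show ?thesis by (simp add: op_power_Suc)
  qed
  have "op_exp X e v = (\<Sum>n\<le>nat (h e). scal (1 / fact n) (op_power X n e v))"
    by (rule op_exp_eq_sum) simp
  then have "const_term (op_exp X e v) = (\<Sum>n\<le>nat (h e). 1 / fact n * const_term (op_power X n e v))"
    by (simp add: lookup_sum lookup_scal)
  also have "\<dots> = (\<Sum>n\<in>{0}. 1 / fact n * const_term (op_power X n e v))"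
    by (rule sum.mono_neutral_right) (auto simp: 1)
  finally show ?thesis by (simp add: op_power_0)
qed

context
  fixes D :: "'a Gamma \<Rightarrow> 'a Gamma" and I :: "nat set" and s :: "nat \<Rightarrow> 'e" and c :: "nat \<Rightarrow> 'a"
  assumes D: "linear_op D" and I: "finite I"
    and comm: "\<And>e v. D (X e v) = X e (D v) + (\<Sum>i\<in>I. scal (if e = s i then c i else 0) v)"
begin

text \<open>Since \<open>[D, X]\<close> is a scalar series \<open>f\<close>, it follows that \<open>[D, X\<^sup>n] = n f X\<^bsup>n-1\<^esup>\<close>, and hence
  \<open>[D, exp X] = f exp X\<close>.\<close>

lemma op_power_comm:
  "D (op_power X n e v) = op_power X n e (D v) +
     (\<Sum>i\<in>I. scal (of_nat n * c i) (op_power X (n - 1) (e - s i) v))"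
proof (induction n arbitrary: e)
  case 0
  then show ?case by (simp add: op_power_0 op_one_def linear_op_0[OF D])
next
  case (Suc n)
  define S where "S n e v = {k. X k \<noteq> (\<lambda>_. 0) \<and> op_power X n (e - k) v \<noteq> 0}" for n e v
  have fin: "finite (S n e v)" for n e v
    using composable_op_power by (simp add: S_def composable_def)
  have eq: "op_power X (Suc n) e v = (\<Sum>k\<in>K. X k (op_power X n (e - k) v))"
    if "finite K" "S n e v \<subseteq> K" for n e v K
    using op_times_eq_sum[OF exponentiable_linear that(1)] that(2) by (simp add: S_def op_power_Suc)
  define K where "K = S n e v \<union> S n e (D v) \<union> (\<Union>i\<in>I. S (n - 1) (e - s i) v) \<union> s ` I"
  have finK: "finite K" using I fin by (simp add: K_def)
  \<comment> \<open>In \<open>D X X\<^sup>n = X (D X\<^sup>n) + [D, X] X\<^sup>n\<close>, the inner commutator contributes \<open>n f X\<^sup>n\<close>, the outer one \<open>f X\<^sup>n\<close>.\<close>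
  have inner: "(\<Sum>k\<in>K. scal (of_nat n * c i) (X k (op_power X (n - 1) (e - k - s i) v))) =
      scal (of_nat n * c i) (op_power X n (e - s i) v)" if "i \<in> I" for i
  proof (cases n)
    case (Suc m)
    have swap: "e - k - s i = e - s i - k" for k by simp
    have "op_power X (Suc m) (e - s i) v = (\<Sum>k\<in>K. X k (op_power X m (e - s i - k) v))"
      using finK that by (intro eq) (auto simp: K_def Suc)
    then show ?thesis by (simp add: Suc scal_sum swap)
  qed simp
  have outer: "(\<Sum>k\<in>K. scal (if k = s i then c i else 0) (op_power X n (e - k) v)) =
      scal (c i) (op_power X n (e - s i) v)" if "i \<in> I" for i
  proof -
    have "(\<Sum>k\<in>K. scal (if k = s i then c i else 0) (op_power X n (e - k) v)) =
        (\<Sum>k\<in>K. if k = s i then scal (c i) (op_power X n (e - k) v) else 0)"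
      by (intro sum.cong) auto
    then show ?thesis using finK that by (simp add: K_def)
  qed
  have "D (op_power X (Suc n) e v) = (\<Sum>k\<in>K. D (X k (op_power X n (e - k) v)))"
    using finK by (subst eq[of K]) (auto simp: K_def linear_op_sum[OF D])
  also have "\<dots> = (\<Sum>k\<in>K. X k (op_power X n (e - k) (D v)) +
      (\<Sum>i\<in>I. scal (of_nat n * c i) (X k (op_power X (n - 1) (e - k - s i) v))) +
      (\<Sum>i\<in>I. scal (if k = s i then c i else 0) (op_power X n (e - k) v)))"
    by (intro sum.cong refl)
      (simp add: comm Suc.IH linear_op_add[OF exponentiable_linear]
        linear_op_sum[OF exponentiable_linear] linear_op_scal[OF exponentiable_linear])
  also have "\<dots> = (\<Sum>k\<in>K. X k (op_power X n (e - k) (D v))) +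
      (\<Sum>i\<in>I. \<Sum>k\<in>K. scal (of_nat n * c i) (X k (op_power X (n - 1) (e - k - s i) v))) +
      (\<Sum>i\<in>I. \<Sum>k\<in>K. scal (if k = s i then c i else 0) (op_power X n (e - k) v))"
    by (simp add: sum.distrib sum.swap[of _ I K])
  also have "(\<Sum>k\<in>K. X k (op_power X n (e - k) (D v))) = op_power X (Suc n) e (D v)"
    using finK by (intro eq[symmetric]) (auto simp: K_def)
  finally show ?case
    by (simp add: inner[unfolded One_nat_def] outer add.assoc distrib_right scal_add_left add_ac flip: sum.distrib)
qed

lemma shift_comm_exp: "shift_comm D I s c (op_exp X)"
  unfolding shift_comm_def
proof (intro allI)
  fix e v
  define M where "M = nat (h e) + (\<Sum>i\<in>I. nat (h (e - s i)))"
  have M: "h e \<le> int (Suc M)" unfolding M_def by linarith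
  have Ms: "h (e - s i) \<le> int M" if "i \<in> I" for i
  proof -
    have "nat (h (e - s i)) \<le> (\<Sum>i\<in>I. nat (h (e - s i)))"
      using I that by (intro member_le_sum) auto
    then show ?thesis unfolding M_def by linarith
  qed
  have "D (op_exp X e v) = op_exp X e (D v) +
      (\<Sum>n\<le>Suc M. \<Sum>i\<in>I. scal (of_nat n / fact n * c i) (op_power X (n - 1) (e - s i) v))"
    by (simp add: op_exp_eq_sum[OF M] linear_op_sum[OF D] linear_op_scal[OF D] op_power_comm
        scal_add scal_sum sum.distrib add_ac linear_op_add[OF D] del: sum.atMost_Suc)
  also have "(\<Sum>n\<le>Suc M. \<Sum>i\<in>I. scal (of_nat n / fact n * c i) (op_power X (n - 1) (e - s i) v)) =
      (\<Sum>n\<le>M. \<Sum>i\<in>I. scal (1 / fact n * c i) (op_power X n (e - s i) v))"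
    by (subst sum.atMost_Suc_shift) (simp del: of_nat_Suc)
  also have "\<dots> = (\<Sum>i\<in>I. scal (c i) (\<Sum>n\<le>M. scal (1 / fact n) (op_power X n (e - s i) v)))"
    by (subst sum.swap) (simp add: scal_sum)
  also have "\<dots> = (\<Sum>i\<in>I. scal (c i) (op_exp X (e - s i) v))"
    by (simp add: op_exp_eq_sum[OF Ms])
  finally show "D (op_exp X e v) =
      op_exp X e (D v) + (\<Sum>i\<in>I. scal (c i) (op_exp X (e - s i) v))" .
qed

end

end

text \<open>The finiteness condition need only be checked on the vacuum vector \<open>1\<close>: by the commutation
  relation, multiplication of \<open>v\<close> by a variable enlarges the relevant set of exponents by finitely many
  translates.\<close>

lemma composable_of_vacuum:
  fixes X Y :: "('e::ab_group_add, 'a::field_char_0) op_series"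
  assumes Y: "\<And>e. linear_op (Y e)" and I: "finite I"
    and comm: "\<And>n. odd n \<Longrightarrow> shift_comm ((*) (pvar n)) I (s n) (c n) Y"
    and one: "\<And>e. finite {k. X k \<noteq> (\<lambda>_. 0) \<and> Y (e - k) 1 \<noteq> 0}"
  shows "composable X Y"
proof -
  define S where "S e v = {k. X k \<noteq> (\<lambda>_. 0) \<and> Y (e - k) v \<noteq> 0}" for e v
  have "finite (S e v)" for e v
  proof (induction v arbitrary: e rule: Gamma_induct)
    case one
    then show ?case using assms(4) by (simp add: S_def)
  next
    case (scal c v)
    have "S e (scal c v) \<subseteq> S e v" by (auto simp: S_def linear_op_scal[OF Y])
    then show ?case using scal by (rule finite_subset)
  next
    case (add v w)
    have "S e (v + w) \<subseteq> S e v \<union> S e w" by (auto simp: S_def linear_op_add[OF Y])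
    then show ?case using add by (meson finite_UnI finite_subset)
  next
    case (pvar n v)
    have "S e (pvar n * v) \<subseteq> S e v \<union> (\<Union>i\<in>I. S (e - s n i) v)"
    proof
      fix k assume k: "k \<in> S e (pvar n * v)"
      have swap: "e - k - s n i = e - s n i - k" for i by simp
      show "k \<in> S e v \<union> (\<Union>i\<in>I. S (e - s n i) v)"
      proof (rule ccontr)
        assume "\<not> ?thesis"
        then have "Y (e - k) v = 0" "\<And>i. i \<in> I \<Longrightarrow> Y (e - k - s n i) v = 0"
          using k by (auto simp: S_def swap)
        then have "Y (e - k) (pvar n * v) = 0"
          using shift_commD[OF comm[OF pvar.hyps], of "e - k" v] by simp
        then show False using k by (simp add: S_def)
      qed
    qed
    then show ?case
      by (rule finite_subset) (simp add: I pvar.IH)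
  qed
  then show ?thesis by (simp add: composable_def S_def)
qed

section \<open>Uniqueness of operator series\<close>

lemma shift_comm_superset:
  assumes "shift_comm D I s c X" "finite J" "I \<subseteq> J"
  shows "shift_comm D J s (\<lambda>i. if i \<in> I then c i else 0) X"
proof -
  have "(\<Sum>i\<in>J. scal (if i \<in> I then c i else 0) (X (e - s i) v)) =
      (\<Sum>i\<in>I. scal (c i) (X (e - s i) v))" for e v
    by (rule sum.mono_neutral_cong_right) (use assms in auto)
  then show ?thesis using assms(1) by (simp add: shift_comm_def)
qed

lemma shift_comm_cong:
  "shift_comm D I s c X \<Longrightarrow> (\<And>i. i \<in> I \<Longrightarrow> c i = d i) \<Longrightarrow> shift_comm D I s d X"
  by (simp add: shift_comm_def)

text \<open>Uniqueness: the Fock space is generated from the vacuum by the variables, and a vector is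
  determined by the constant terms of its derivatives.  So a series is determined by its commutation
  relations and its vacuum expectation values.\<close>

lemma op_series_eqI:
  fixes X Y :: "('e::ab_group_add, 'a::field_char_0) op_series"
  assumes X: "\<And>e. linear_op (X e)" and Y: "\<And>e. linear_op (Y e)"
    and pdX: "\<And>n. odd n \<Longrightarrow> shift_comm (pdiff n) I (s n) (a n) X"
    and pdY: "\<And>n. odd n \<Longrightarrow> shift_comm (pdiff n) I (s n) (a n) Y"
    and pvX: "\<And>n. odd n \<Longrightarrow> shift_comm ((*) (pvar n)) I (s' n) (b n) X"
    and pvY: "\<And>n. odd n \<Longrightarrow> shift_comm ((*) (pvar n)) I (s' n) (b n) Y"
    and const: "\<And>e. const_term (X e 1) = const_term (Y e 1)"
  shows "X = Y"
proof (intro ext)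
  have vacuum: "X e 1 - Y e 1 = 0" for e
  proof (rule Gamma_family_eq_0[where f = "\<lambda>e. X e 1 - Y e 1" and I = "\<lambda>_. I" and c = a
        and g = "\<lambda>n i e. e - s n i"])
    show "const_term (X e 1 - Y e 1) = 0" for e
      by (simp add: lookup_minus const)
    fix n :: nat and e assume "odd n"
    have "pdiff n (X e 1 - Y e 1) = pdiff n (X e 1) - pdiff n (Y e 1)"
      by (metis add_diff_cancel_right' diff_add_cancel pdiff_add)
    then show "pdiff n (X e 1 - Y e 1) =
        (\<Sum>i\<in>I. scal (a n i) (X (e - s n i) 1 - Y (e - s n i) 1))"
      using shift_commD[OF pdX[OF \<open>odd n\<close>], of e 1] shift_commD[OF pdY[OF \<open>odd n\<close>], of e 1]
      by (simp add: linear_op_0[OF X] linear_op_0[OF Y] scal_diff sum_subtractf)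
  qed
  fix e v
  show "X e v = Y e v"
  proof (induction v arbitrary: e rule: Gamma_induct)
    case one
    then show ?case using vacuum[of e] by simp
  next
    case (scal c v)
    then show ?case by (simp add: linear_op_scal[OF X] linear_op_scal[OF Y])
  next
    case (add v w)
    then show ?case by (simp add: linear_op_add[OF X] linear_op_add[OF Y])
  next
    case (pvar n v)
    have "X e (pvar n * v) = pvar n * X e v - (\<Sum>i\<in>I. scal (b n i) (X (e - s' n i) v))"
      using shift_commD[OF pvX[OF pvar.hyps], of e v] by simp
    moreover have "Y e (pvar n * v) = pvar n * Y e v - (\<Sum>i\<in>I. scal (b n i) (Y (e - s' n i) v))"
      using shift_commD[OF pvY[OF pvar.hyps], of e v] by simp
    ultimately show ?case by (simp add: pvar.IH)
  qed
qed

section \<open>Vertex operators in one variable\<close>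

text \<open>The scalars in the commutation relations of the vertex operators: \<open>alpha t n\<close> for the derivative
  with respect to \<open>p\<^sub>n\<close>, \<open>beta t n\<close> for the multiplication by \<open>p\<^sub>n\<close>, and \<open>gamma t s n\<close> for the contraction of
  the \<open>B\<close>-part with parameter \<open>t\<close> and the \<open>A\<close>-part with parameter \<open>s\<close>.\<close>

definition alpha :: "'a::field_char_0 \<Rightarrow> nat \<Rightarrow> 'a" where
  "alpha t n = 2 * (1 - t ^ n) / of_nat n"

definition beta :: "'a::field_char_0 \<Rightarrow> nat \<Rightarrow> 'a" where
  "beta t n = 1 / (1 - t ^ n)"

definition gamma :: "'a::field_char_0 \<Rightarrow> 'a \<Rightarrow> nat \<Rightarrow> 'a" where
  "gamma t s n = 2 * (1 - s ^ n) / (1 - t ^ n)"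

lemma gamma_eq: "odd n \<Longrightarrow> of_nat n * beta t n * alpha s n = gamma t s n"
  by (simp add: gamma_def alpha_def beta_def odd_pos)

lemma A_series_eq:
  "A_series t k v = (if k > 0 \<and> odd k then scal (alpha t (nat k)) (pvar (nat k) * v) else 0)"
  by (simp add: A_series_def heis_def alpha_def)

lemma B_series_eq:
  "B_series t k v = (if k < 0 \<and> odd k then scal (- beta t (nat (- k))) (pdiff (nat (- k)) v) else 0)"
proof -
  have "- (2 / (of_int (- k) * d)) * (of_int (- k) / 2) = - (1 / d)" if "k < 0" for d :: 'a
    using that by (cases "d = 0") (simp_all add: field_simps)
  then have "scal (- (2 / (of_int (- k) * d))) (heis (- k) v) = scal (- (1 / d)) (pdiff (nat (- k)) v)"
    if "k < 0" for d :: 'a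
    using that by (simp only: heis_def scal_scal) simp
  then show ?thesis
    unfolding B_series_def beta_def by (simp del: of_int_minus)
qed

lemma linear_A_series: "linear_op (A_series t k)"
  by (rule linear_opI) (simp_all add: A_series_eq distrib_left scal_add scal_mult_right mult.commute)

lemma linear_B_series: "linear_op (B_series t k)"
  by (rule linear_opI) (simp_all add: B_series_eq pdiff_add pdiff_scal scal_add mult.commute)

lemma A_series_nonzero: "A_series t k \<noteq> (\<lambda>_. 0) \<Longrightarrow> k > 0"
  and B_series_nonzero: "B_series t k \<noteq> (\<lambda>_. 0) \<Longrightarrow> k < 0"
  by (auto simp: fun_eq_iff A_series_eq B_series_eq split: if_splits)

lemma pdiff_A_series:
  assumes "odd n"
  shows "pdiff n (A_series t k v) =
     A_series t k (pdiff n v) + scal (if k = int n then alpha t n else 0) v"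
proof -
  have "n div 2 = nat k div 2 \<longleftrightarrow> k = int n" if "k > 0" "odd k"
  proof -
    have "odd (nat k)" using that by (simp add: even_nat_iff)
    then have "n div 2 = nat k div 2 \<longleftrightarrow> n = nat k" using assms
      by (metis odd_two_times_div_two_succ)
    then show ?thesis using that by auto
  qed
  then show ?thesis using assms
    by (auto simp: A_series_eq pdiff_scal pdiff_pvar_mult scal_add odd_pos)
qed

lemma pvar_A_series: "pvar n * A_series t k v = A_series t k (pvar n * v)"
  by (simp add: A_series_eq scal_mult_right mult.left_commute)

lemma pdiff_commute: "pdiff n (pdiff m v) = pdiff m (pdiff n v)"
proof (rule poly_mapping_eqI)
  fix u
  show "Poly_Mapping.lookup (pdiff n (pdiff m v)) u = Poly_Mapping.lookup (pdiff m (pdiff n v)) u"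
    by (cases "n div 2 = m div 2") (simp_all add: lookup_pdiff lookup_add lookup_single add_ac)
qed

lemma pdiff_B_series: "pdiff n (B_series t k v) = B_series t k (pdiff n v)"
  by (simp add: B_series_eq pdiff_scal pdiff_commute[of n])

lemma pvar_B_series:
  assumes "odd n"
  shows "pvar n * B_series t k v =
     B_series t k (pvar n * v) + scal (if k = - int n then beta t n else 0) v"
proof -
  have "nat (- k) div 2 = n div 2 \<longleftrightarrow> k = - int n" if "k < 0" "odd k"
  proof -
    have "odd (nat (- k))" using that by (simp add: even_nat_iff)
    then have "nat (- k) div 2 = n div 2 \<longleftrightarrow> nat (- k) = n" using assms
      by (metis odd_two_times_div_two_succ)
    then show ?thesis using that by auto
  qed
  then show ?thesis using assms
    by (auto simp: B_series_eq pdiff_pvar_mult scal_add scal_mult_right odd_pos scal_minus_left)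
qed

lemma const_term_A_series: "const_term (A_series t k v) = 0"
  by (simp add: A_series_eq lookup_scal)

lemma B_series_1: "B_series t k 1 = 0"
  by (simp add: B_series_eq)

lemma exponentiable_A_series: "exponentiable id (A_series t)"
proof -
  have "finite {k. A_series t k \<noteq> (\<lambda>_. 0) \<and> k \<le> N}" for N
    by (rule finite_subset[of _ "{0..N}"]) (auto dest: A_series_nonzero)
  then show ?thesis
    using A_series_nonzero by (fastforce simp: exponentiable_def linear_A_series)
qed

lemma exponentiable_B_series: "exponentiable uminus (B_series t)"
proof -
  have "finite {k. B_series t k \<noteq> (\<lambda>_. 0) \<and> - k \<le> N}" for N
    by (rule finite_subset[of _ "{-N..0}"]) (auto dest: B_series_nonzero)
  then show ?thesis
    using B_series_nonzero by (fastforce simp: exponentiable_def linear_B_series)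
qed

text \<open>The relations are stated with an arbitrary one-element index set \<open>{i}\<close>, so that they can be
  transferred to the variable \<open>z\<^sub>i\<close>.\<close>

lemma pdiff_exp_A:
  "odd n \<Longrightarrow> shift_comm (pdiff n) {i} (\<lambda>_. int n) (\<lambda>_. alpha t n) (op_exp (A_series t))"
  by (rule shift_comm_exp[OF exponentiable_A_series]) (simp_all add: linear_op_pdiff pdiff_A_series)

lemma pvar_exp_A:
  "shift_comm ((*) (pvar n)) {i} s (\<lambda>_. 0) (op_exp (A_series t))"
  by (rule shift_comm_exp[OF exponentiable_A_series]) (simp_all add: linear_op_pvar pvar_A_series)

lemma pdiff_exp_B:
  "shift_comm (pdiff n) {i} s (\<lambda>_. 0) (op_exp (B_series t))"
  by (rule shift_comm_exp[OF exponentiable_B_series]) (simp_all add: linear_op_pdiff pdiff_B_series)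

lemma pvar_exp_B:
  "odd n \<Longrightarrow> shift_comm ((*) (pvar n)) {i} (\<lambda>_. - int n) (\<lambda>_. beta t n) (op_exp (B_series t))"
  by (rule shift_comm_exp[OF exponentiable_B_series]) (simp_all add: linear_op_pvar pvar_B_series)

lemma exp_B_1: "op_exp (B_series t) k 1 = op_one k 1"
  by (rule op_exp_vacuum[OF exponentiable_B_series]) (simp add: B_series_1)

lemma const_term_exp_A: "const_term (op_exp (A_series t) k v) = const_term (op_one k v)"
  by (rule op_exp_covacuum[OF exponentiable_A_series]) (simp add: const_term_A_series)

lemma linear_exp_A: "linear_op (op_exp (A_series t) k)"
  and linear_exp_B: "linear_op (op_exp (B_series t) k)"
  by (rule linear_op_exp[OF exponentiable_A_series] linear_op_exp[OF exponentiable_B_series])+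

lemma exp_B_pos: "k > 0 \<Longrightarrow> op_exp (B_series t) k v = 0"
  by (rule op_exp_height_neg[OF exponentiable_B_series]) simp

lemma exp_B_0: "op_exp (B_series t) 0 v = v"
  by (subst op_exp_height_0[OF exponentiable_B_series]) (simp_all add: op_one_def)

lemma composable_exp_A_exp_B: "composable (op_exp (A_series t)) (op_exp (B_series t))"
proof (rule composable_of_vacuum[where I = "{0}"])
  fix e
  have "{k. op_exp (A_series t) k \<noteq> (\<lambda>_. 0) \<and> op_exp (B_series t) (e - k) 1 \<noteq> 0} \<subseteq> {e}"
    by (auto simp: exp_B_1 op_one_def split: if_splits)
  then show "finite {k. op_exp (A_series t) k \<noteq> (\<lambda>_. 0) \<and> op_exp (B_series t) (e - k) 1 \<noteq> 0}"
    by (rule finite_subset) simp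
qed (auto simp: linear_exp_B intro: pvar_exp_B)

lemma linear_Y: "linear_op (Y_series t k)"
  unfolding Y_series_def
  by (intro linear_op_times linear_exp_A linear_exp_B composable_exp_A_exp_B)

lemma pdiff_Y:
  assumes "odd n"
  shows "shift_comm (pdiff n) {i} (\<lambda>_. int n) (\<lambda>_. alpha t n) (Y_series t)"
proof -
  have "shift_comm (pdiff n) {i} (\<lambda>_. int n) (\<lambda>i. alpha t n + 0) (Y_series t)"
    unfolding Y_series_def
    by (intro shift_comm_times linear_op_pdiff linear_exp_A linear_exp_B composable_exp_A_exp_B
        pdiff_exp_A pdiff_exp_B assms) simp
  then show ?thesis by simp
qed

lemma pvar_Y:
  assumes "odd n"
  shows "shift_comm ((*) (pvar n)) {i} (\<lambda>_. - int n) (\<lambda>_. beta t n) (Y_series t)"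
proof -
  have "shift_comm ((*) (pvar n)) {i} (\<lambda>_. - int n) (\<lambda>i. 0 + beta t n) (Y_series t)"
    unfolding Y_series_def
    by (intro shift_comm_times linear_op_pvar linear_exp_A linear_exp_B composable_exp_A_exp_B
        pvar_exp_A pvar_exp_B assms) simp
  then show ?thesis by simp
qed

lemma const_term_Y: "const_term (Y_series t k v) = const_term (op_exp (B_series t) k v)"
proof -
  let ?A = "op_exp (A_series t)" and ?B = "op_exp (B_series t)"
  let ?K = "insert 0 {j. ?A j \<noteq> (\<lambda>_. 0) \<and> ?B (k - j) v \<noteq> 0}"
  have fin: "finite ?K"
    by (intro finite.insertI composable_exp_A_exp_B[unfolded composable_def, rule_format])
  then have "Y_series t k v = (\<Sum>j\<in>?K. ?A j (?B (k - j) v))"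
    unfolding Y_series_def by (intro op_times_eq_sum linear_exp_A) auto
  then have "const_term (Y_series t k v) =
      (\<Sum>j\<in>?K. if j = 0 then const_term (?B (k - j) v) else 0)"
    by (simp only: lookup_sum const_term_exp_A op_one_def if_distrib[of const_term] lookup_zero)
  then show ?thesis using fin by simp
qed

text \<open>The differential equation \<open>z (d/dz) e\<^bsup>B(z)\<^esup> = e\<^bsup>B(z)\<^esup> (z (d/dz) B(z))\<close> in coefficients.  The sum may
  stop at any \<open>N \<ge> -k\<close>, as the coefficients of positive powers of \<open>z\<close> vanish.\<close>

lemma euler_exp_B:
  assumes "- k \<le> int N"
  shows "scal (of_int k) (op_exp (B_series t) k v) =
     (\<Sum>n | n \<le> N \<and> odd n. scal (of_nat n * beta t n) (op_exp (B_series t) (k + int n) (pdiff n v)))"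
  using assms
proof (induction v arbitrary: k rule: Gamma_induct)
  case one
  then show ?case by (simp add: exp_B_1 op_one_def linear_op_0[OF linear_exp_B])
next
  case (scal c v)
  have comm: "scal a (scal c w) = scal c (scal a w)" for a and w :: "'a Gamma"
    by (simp add: mult.commute)
  show ?case
    by (simp only: pdiff_scal linear_op_scal[OF linear_exp_B] comm scal.IH[OF scal.prems] scal_sum)
next
  case (add v w)
  then show ?case
    by (simp add: pdiff_add linear_op_add[OF linear_exp_B] scal_add sum.distrib)
next
  case (pvar m v)
  let ?E = "op_exp (B_series t)" and ?O = "{n. n \<le> N \<and> odd n}"
  have E: "?E k (pvar m * v) = pvar m * ?E k v - scal (beta t m) (?E (k + int m) v)" for k v
    using shift_commD[OF pvar_exp_B[OF pvar.hyps, of 0 t], of k v] by simp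
  have diag: "n div 2 = m div 2 \<longleftrightarrow> n = m" if "odd n" for n
    using that pvar.hyps by (metis odd_two_times_div_two_succ)
  \<comment> \<open>If \<open>m > N\<close>, the right-hand side vanishes as well, because then \<open>k + m > 0\<close>.\<close>
  have top: "(\<Sum>n\<in>?O. if n = m then scal (of_nat n * beta t n) (?E (k + int n) v) else 0) =
      scal (of_nat m * beta t m) (?E (k + int m) v)"
    using pvar.hyps pvar.prems by (subst sum.delta) (auto simp: exp_B_pos)
  have "(\<Sum>n\<in>?O. scal (of_nat n * beta t n) (?E (k + int n) (pdiff n (pvar m * v)))) =
      (\<Sum>n\<in>?O. pvar m * scal (of_nat n * beta t n) (?E (k + int n) (pdiff n v)) -
        scal (beta t m) (scal (of_nat n * beta t n) (?E (k + int m + int n) (pdiff n v))) +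
        (if n = m then scal (of_nat n * beta t n) (?E (k + int n) v) else 0))"
  proof (intro sum.cong refl)
    fix n assume "n \<in> ?O"
    then have "pdiff n (pvar m * v) = pvar m * pdiff n v + (if n = m then v else 0)"
      by (simp add: pdiff_pvar_mult diag)
    moreover have "scal (of_nat n * beta t n) (scal (beta t m) w) =
        scal (beta t m) (scal (of_nat n * beta t n) w)" for w :: "'a Gamma"
      by (simp add: mult_ac)
    moreover have "k + int n + int m = k + int m + int n" by simp
    ultimately show "scal (of_nat n * beta t n) (?E (k + int n) (pdiff n (pvar m * v))) =
        pvar m * scal (of_nat n * beta t n) (?E (k + int n) (pdiff n v)) -
        scal (beta t m) (scal (of_nat n * beta t n) (?E (k + int m + int n) (pdiff n v))) +
        (if n = m then scal (of_nat n * beta t n) (?E (k + int n) v) else 0)"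
      by (cases "n = m") (simp_all only: linear_op_add[OF linear_exp_B] E scal_add scal_diff
          scal_mult_right linear_op_0[OF linear_exp_B] if_True if_False add_0_right scal_0 simp_thms)
  qed
  also have "\<dots> = pvar m * scal (of_int k) (?E k v) -
      scal (beta t m) (scal (of_int (k + int m)) (?E (k + int m) v)) +
      scal (of_nat m * beta t m) (?E (k + int m) v)"
    using pvar.IH[of k] pvar.IH[of "k + int m"] pvar.prems
    by (simp add: sum.distrib sum_subtractf top scal_sum sum_distrib_left)
  also have "\<dots> = scal (of_int k) (?E k (pvar m * v))"
    by (simp add: E scal_diff scal_add scal_mult_right scal_add_left
        mult.commute[of "of_int k" "beta t m"] mult.commute[of "of_nat m" "beta t m"])
  finally show ?case ..
qed

section \<open>Products of vertex operators and their vacuum expectation values\<close>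

lemma linear_at_var: "(\<And>k. linear_op (X k)) \<Longrightarrow> linear_op (at_var i X e)"
  by (rule linear_opI) (simp_all add: at_var_def linear_op_add linear_op_scal)

lemma eq_single_diff_iff:
  "e - Poly_Mapping.single i k = Poly_Mapping.single i (Poly_Mapping.lookup e i - k) \<longleftrightarrow>
     e = Poly_Mapping.single i (Poly_Mapping.lookup e i :: int)"
  by (simp add: diff_eq_eq single_diff)

lemma shift_comm_at_var:
  assumes D: "linear_op D" and X: "shift_comm D {i} (\<lambda>_. n) c X"
  shows "shift_comm D {i} (\<lambda>j. Poly_Mapping.single j n) c (at_var i X)"
  unfolding shift_comm_def
proof (intro allI)
  fix e v
  show "D (at_var i X e v) = at_var i X e (D v) +
      (\<Sum>j\<in>{i}. scal (c j) (at_var i X (e - Poly_Mapping.single j n) v))"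
    using shift_commD[OF X, of "Poly_Mapping.lookup e i" v]
    by (simp add: at_var_def linear_op_0[OF D] lookup_minus eq_single_diff_iff)
qed

context
  fixes t :: "nat \<Rightarrow> 'a::field_char_0" and r :: nat
begin

text \<open>The product \<open>\<Y>(z\<^sub>m;t\<^sub>m) \<dots> \<Y>(z\<^sub>r;t\<^sub>r)\<close>.  Peeling off the first factor gives a recursion on \<open>m\<close>.\<close>

definition Ys :: "nat \<Rightarrow> (nat \<Rightarrow>\<^sub>0 int, 'a) op_series" where
  "Ys m = op_prod [at_var i (Y_series (t i)). i \<leftarrow> [m..<Suc r]]"

lemma Ys_Suc_r: "Ys (Suc r) = op_one"
  by (simp add: Ys_def op_prod_def)

lemma Ys_rec: "m \<le> r \<Longrightarrow> Ys m = op_times (at_var m (Y_series (t m))) (Ys (Suc m))"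
  by (simp add: Ys_def op_prod_def upt_conv_Cons del: upt_Suc)

lemma op_times_at_var:
  assumes X: "\<And>k. linear_op (X k)" and Y: "\<And>e v. Y e v \<noteq> 0 \<Longrightarrow> Poly_Mapping.lookup e i = 0"
  shows "op_times (at_var i X) Y e v =
    X (Poly_Mapping.lookup e i) (Y (e - Poly_Mapping.single i (Poly_Mapping.lookup e i)) v)"
    and "composable (at_var i X) Y"
proof -
  have sub: "{k. at_var i X k \<noteq> (\<lambda>_. 0) \<and> Y (e - k) v \<noteq> 0} \<subseteq>
      {Poly_Mapping.single i (Poly_Mapping.lookup e i)}" for e v
  proof
    fix k assume "k \<in> {k. at_var i X k \<noteq> (\<lambda>_. 0) \<and> Y (e - k) v \<noteq> 0}"
    then have "k = Poly_Mapping.single i (Poly_Mapping.lookup k i)" "Poly_Mapping.lookup (e - k) i = 0"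
      using Y by (auto simp: at_var_def fun_eq_iff split: if_splits)
    then show "k \<in> {Poly_Mapping.single i (Poly_Mapping.lookup e i)}"
      by (simp add: lookup_minus)
  qed
  show "composable (at_var i X) Y"
    unfolding composable_def using finite_subset[OF sub] by blast
  have "op_times (at_var i X) Y e v =
      (\<Sum>k\<in>{Poly_Mapping.single i (Poly_Mapping.lookup e i)}. at_var i X k (Y (e - k) v))"
    by (rule op_times_eq_sum[OF linear_at_var[OF X] _ sub]) simp
  then show "op_times (at_var i X) Y e v =
    X (Poly_Mapping.lookup e i) (Y (e - Poly_Mapping.single i (Poly_Mapping.lookup e i)) v)"
    by (simp add: at_var_def)
qed

lemma Ys_support:
  assumes "m \<le> Suc r" "Ys m e v \<noteq> 0" "i < m"
  shows "Poly_Mapping.lookup e i = 0"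
  using assms
proof (induction m arbitrary: e v i rule: inc_induct)
  case base
  then show ?case by (simp add: Ys_Suc_r op_one_def split: if_splits)
next
  case (step m)
  let ?k = "Poly_Mapping.single m (Poly_Mapping.lookup e m)"
  have "Ys m e v = Y_series (t m) (Poly_Mapping.lookup e m) (Ys (Suc m) (e - ?k) v)"
    using step.hyps step.IH[where i = m] by (simp add: Ys_rec op_times_at_var(1)[OF linear_Y])
  then have "Ys (Suc m) (e - ?k) v \<noteq> 0"
    using step.prems by (auto simp: linear_op_0[OF linear_Y])
  then have "Poly_Mapping.lookup (e - ?k) i = 0"
    using step.prems by (intro step.IH) auto
  then show ?case
    using step.prems by (simp add: lookup_minus lookup_single)
qed

lemma Ys_step:
  assumes "m \<le> r"
  shows "Ys m e v = Y_series (t m) (Poly_Mapping.lookup e m)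
      (Ys (Suc m) (e - Poly_Mapping.single m (Poly_Mapping.lookup e m)) v)"
    and "composable (at_var m (Y_series (t m))) (Ys (Suc m))"
  using assms Ys_support[of "Suc m" _ _ m]
  by (auto simp: Ys_rec intro!: op_times_at_var linear_Y)

lemma linear_Ys: "m \<le> Suc r \<Longrightarrow> linear_op (Ys m e)"
proof (induction m arbitrary: e rule: inc_induct)
  case base
  then show ?case by (simp add: Ys_Suc_r linear_op_one)
next
  case (step m)
  then show ?case
    by (simp add: Ys_rec linear_op_times linear_at_var linear_Y Ys_step)
qed

lemma shift_comm_Ys:
  assumes D: "linear_op D"
    and Y: "\<And>i. 1 \<le> i \<Longrightarrow> i \<le> r \<Longrightarrow> shift_comm D {i} (\<lambda>_. n) c (Y_series (t i))"
  shows "m \<le> Suc r \<Longrightarrow> 1 \<le> m \<Longrightarrow> shift_comm D {m..r} (\<lambda>i. Poly_Mapping.single i n) c (Ys m)"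
proof (induction m rule: inc_induct)
  case base
  then show ?case
    by (simp add: Ys_Suc_r shift_comm_def op_one_def linear_op_0[OF D])
next
  case (step m)
  let ?s = "\<lambda>i. Poly_Mapping.single i n"
  have m: "m \<le> r" using step by simp
  have 1: "shift_comm D {m..r} ?s (\<lambda>i. if i \<in> {m} then c i else 0) (at_var m (Y_series (t m)))"
    using step m by (intro shift_comm_superset shift_comm_at_var D Y) auto
  have 2: "shift_comm D {m..r} ?s (\<lambda>i. if i \<in> {Suc m..r} then c i else 0) (Ys (Suc m))"
    using step by (intro shift_comm_superset step.IH) auto
  have "shift_comm D {m..r} ?s (\<lambda>i. (if i \<in> {m} then c i else 0) +
      (if i \<in> {Suc m..r} then c i else 0)) (Ys m)"
    unfolding Ys_rec[OF m]
    by (intro shift_comm_times D linear_at_var linear_Y linear_Ys Ys_step 1 2) (use m in auto)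
  then show ?case by (rule shift_comm_cong) auto
qed

lemma pdiff_Ys:
  assumes "odd n" "1 \<le> m" "m \<le> Suc r"
  shows "shift_comm (pdiff n) {m..r} (\<lambda>i. Poly_Mapping.single i (int n)) (\<lambda>i. alpha (t i) n) (Ys m)"
  using assms by (intro shift_comm_Ys linear_op_pdiff shift_comm_cong[OF pdiff_Y]) auto

lemma pvar_Ys:
  assumes "odd n" "1 \<le> m" "m \<le> Suc r"
  shows "shift_comm ((*) (pvar n)) {m..r} (\<lambda>i. Poly_Mapping.single i (- int n)) (\<lambda>i. beta (t i) n) (Ys m)"
  using assms by (intro shift_comm_Ys linear_op_pvar shift_comm_cong[OF pvar_Y]) auto

text \<open>The vacuum expectation value satisfies the first-order differential equation \<open>euler_Ys\<close> in \<open>z\<^sub>m\<close>: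
  the \<open>A\<close>-part of the first factor vanishes against the dual vacuum, and its \<open>B\<close>-part is contracted with
  the \<open>A\<close>-parts of the other factors.\<close>

lemma const_term_Ys_pos:
  assumes "m \<le> r" "Poly_Mapping.lookup e m > 0"
  shows "const_term (Ys m e 1) = 0"
  using assms by (simp add: Ys_step const_term_Y exp_B_pos)

lemma const_term_Ys_0:
  assumes "m \<le> r" "Poly_Mapping.lookup e m = 0"
  shows "const_term (Ys m e 1) = const_term (Ys (Suc m) e 1)"
  using assms by (simp add: Ys_step const_term_Y exp_B_0)

lemma euler_Ys:
  assumes m: "1 \<le> m" "m \<le> r" and N: "- Poly_Mapping.lookup e m \<le> int N"
  shows "of_int (Poly_Mapping.lookup e m) * const_term (Ys m e 1) =
     (\<Sum>n | n \<le> N \<and> odd n. \<Sum>j\<in>{Suc m..r}. gamma (t m) (t j) n *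
        const_term (Ys m (e + Poly_Mapping.single m (int n) - Poly_Mapping.single j (int n)) 1))"
proof -
  let ?k = "Poly_Mapping.lookup e m"
  let ?f = "e - Poly_Mapping.single m ?k"
  let ?E = "op_exp (B_series (t m))"
  have "of_int ?k * const_term (Ys m e 1) = const_term (scal (of_int ?k) (?E ?k (Ys (Suc m) ?f 1)))"
    using m by (simp add: Ys_step const_term_Y lookup_scal)
  also have "\<dots> = (\<Sum>n | n \<le> N \<and> odd n. of_nat n * beta (t m) n *
      const_term (?E (?k + int n) (pdiff n (Ys (Suc m) ?f 1))))"
    by (simp only: euler_exp_B[OF N] lookup_sum lookup_scal)
  also have "\<dots> = (\<Sum>n | n \<le> N \<and> odd n. \<Sum>j\<in>{Suc m..r}. gamma (t m) (t j) n *
        const_term (Ys m (e + Poly_Mapping.single m (int n) - Poly_Mapping.single j (int n)) 1))"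
  proof (intro sum.cong refl)
    fix n assume n: "n \<in> {n. n \<le> N \<and> odd n}"
    have "pdiff n (Ys (Suc m) ?f 1) =
        (\<Sum>j\<in>{Suc m..r}. scal (alpha (t j) n) (Ys (Suc m) (?f - Poly_Mapping.single j (int n)) 1))"
      using shift_commD[OF pdiff_Ys, of n "Suc m" ?f 1] n m
      by (simp add: linear_op_0[OF linear_Ys])
    then have "const_term (?E (?k + int n) (pdiff n (Ys (Suc m) ?f 1))) =
        (\<Sum>j\<in>{Suc m..r}. alpha (t j) n *
          const_term (?E (?k + int n) (Ys (Suc m) (?f - Poly_Mapping.single j (int n)) 1)))"
      by (simp add: linear_op_sum[OF linear_exp_B] linear_op_scal[OF linear_exp_B]
          lookup_sum lookup_scal)
    also have "\<dots> = (\<Sum>j\<in>{Suc m..r}. alpha (t j) n *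
        const_term (Ys m (e + Poly_Mapping.single m (int n) - Poly_Mapping.single j (int n)) 1))"
    proof (intro sum.cong refl arg_cong2[where f = "(*)"])
      fix j assume "j \<in> {Suc m..r}"
      then have "Poly_Mapping.lookup (e + Poly_Mapping.single m (int n) - Poly_Mapping.single j (int n)) m =
          ?k + int n"
        by (simp add: lookup_minus lookup_add lookup_single)
      moreover have "e + Poly_Mapping.single m (int n) - Poly_Mapping.single j (int n) -
          Poly_Mapping.single m (?k + int n) = ?f - Poly_Mapping.single j (int n)"
        by (simp add: single_add)
      ultimately show "const_term (?E (?k + int n) (Ys (Suc m) (?f - Poly_Mapping.single j (int n)) 1)) =
        const_term (Ys m (e + Poly_Mapping.single m (int n) - Poly_Mapping.single j (int n)) 1)"
        by (simp only: Ys_step(1)[OF m(2)] const_term_Y)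
    qed
    finally show "of_nat n * beta (t m) n * const_term (?E (?k + int n) (pdiff n (Ys (Suc m) ?f 1))) =
      (\<Sum>j\<in>{Suc m..r}. gamma (t m) (t j) n *
        const_term (Ys m (e + Poly_Mapping.single m (int n) - Poly_Mapping.single j (int n)) 1))"
      using n by (simp add: sum_distrib_left mult.assoc flip: gamma_eq)
  qed
  finally show ?thesis .
qed

section \<open>The normally ordered product\<close>

text \<open>The total degree in \<open>z\<^sub>1, \<dots>, z\<^sub>r\<close>.\<close>

definition height :: "(nat \<Rightarrow>\<^sub>0 int) \<Rightarrow> int" where
  "height e = (\<Sum>i=1..r. Poly_Mapping.lookup e i)"

text \<open>The sums of the \<open>A\<close>-parts and of the \<open>B\<close>-parts.\<close>

definition As :: "(nat \<Rightarrow>\<^sub>0 int, 'a) op_series" where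
  "As e v = (\<Sum>i=1..r. at_var i (A_series (t i)) e v)"

definition Bs :: "(nat \<Rightarrow>\<^sub>0 int, 'a) op_series" where
  "Bs e v = (\<Sum>i=1..r. at_var i (B_series (t i)) e v)"

lemma height_add: "height (e + f) = height e + height f"
  by (simp add: height_def lookup_add sum.distrib)

lemma height_single: "i \<in> {1..r} \<Longrightarrow> height (Poly_Mapping.single i k) = k"
  by (simp add: height_def lookup_single when_def)

lemma linear_As: "linear_op (As e)" and linear_Bs: "linear_op (Bs e)"
  unfolding As_def Bs_def
  by (intro linear_op_sum_op linear_at_var linear_A_series linear_B_series)+

lemma As_nonzero:
  assumes "As e \<noteq> (\<lambda>_. 0)"
  obtains i k where "i \<in> {1..r}" "k > 0" "e = Poly_Mapping.single i k"
proof -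
  obtain v where "As e v \<noteq> 0" using assms by auto
  then obtain i where "i \<in> {1..r}" "at_var i (A_series (t i)) e v \<noteq> 0"
    unfolding As_def by (meson sum.not_neutral_contains_not_neutral)
  then have "e = Poly_Mapping.single i (Poly_Mapping.lookup e i)"
    and "A_series (t i) (Poly_Mapping.lookup e i) \<noteq> (\<lambda>_. 0)"
    by (auto simp: at_var_def split: if_splits)
  then show ?thesis
    using that \<open>i \<in> {1..r}\<close> A_series_nonzero by blast
qed

lemma Bs_nonzero:
  assumes "Bs e \<noteq> (\<lambda>_. 0)"
  obtains i k where "i \<in> {1..r}" "k < 0" "e = Poly_Mapping.single i k"
proof -
  obtain v where "Bs e v \<noteq> 0" using assms by auto
  then obtain i where "i \<in> {1..r}" "at_var i (B_series (t i)) e v \<noteq> 0"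
    unfolding Bs_def by (meson sum.not_neutral_contains_not_neutral)
  then have "e = Poly_Mapping.single i (Poly_Mapping.lookup e i)"
    and "B_series (t i) (Poly_Mapping.lookup e i) \<noteq> (\<lambda>_. 0)"
    by (auto simp: at_var_def split: if_splits)
  then show ?thesis
    using that \<open>i \<in> {1..r}\<close> B_series_nonzero by blast
qed

lemma exponentiable_As: "exponentiable height As"
proof -
  have "finite {e. As e \<noteq> (\<lambda>_. 0) \<and> height e \<le> N}" for N
  proof (rule finite_subset)
    show "{e. As e \<noteq> (\<lambda>_. 0) \<and> height e \<le> N} \<subseteq>
        (\<lambda>(i, k). Poly_Mapping.single i k) ` ({1..r} \<times> {0..N})"
      by (auto elim!: As_nonzero simp: height_single)
  qed simp
  moreover have "height e \<ge> 1" if "As e \<noteq> (\<lambda>_. 0)" for e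
    using that by (auto elim!: As_nonzero simp: height_single)
  ultimately show ?thesis by (simp add: exponentiable_def linear_As height_add)
qed

lemma exponentiable_Bs: "exponentiable (\<lambda>e. - height e) Bs"
proof -
  have "finite {e. Bs e \<noteq> (\<lambda>_. 0) \<and> - height e \<le> N}" for N
  proof (rule finite_subset)
    show "{e. Bs e \<noteq> (\<lambda>_. 0) \<and> - height e \<le> N} \<subseteq>
        (\<lambda>(i, k). Poly_Mapping.single i k) ` ({1..r} \<times> {-N..0})"
      by (auto elim!: Bs_nonzero simp: height_single)
  qed simp
  moreover have "- height e \<ge> 1" if "Bs e \<noteq> (\<lambda>_. 0)" for e
    using that by (auto elim!: Bs_nonzero simp: height_single)
  ultimately show ?thesis by (simp add: exponentiable_def linear_Bs height_add)
qed

lemma eq_single_iff: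
  "(e = Poly_Mapping.single i (Poly_Mapping.lookup e i) \<and> Poly_Mapping.lookup e i = k) \<longleftrightarrow>
     e = Poly_Mapping.single i k"
  by auto

lemma at_var_comm:
  assumes "linear_op D" and "\<And>k v. D (X k v) = X k (D v) + scal (if k = n then c else 0) v"
  shows "D (at_var i X e v) = at_var i X e (D v) + scal (if e = Poly_Mapping.single i n then c else 0) v"
  using assms(2)[of "Poly_Mapping.lookup e i" v] eq_single_iff[of e i n]
  by (auto simp: at_var_def linear_op_0[OF assms(1)])

lemma pdiff_As:
  assumes "odd n"
  shows "pdiff n (As e v) = As e (pdiff n v) +
    (\<Sum>i=1..r. scal (if e = Poly_Mapping.single i (int n) then alpha (t i) n else 0) v)"
  unfolding As_def linear_op_sum[OF linear_op_pdiff]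
  by (simp only: at_var_comm[OF linear_op_pdiff pdiff_A_series[OF assms]] sum.distrib)

lemma pvar_As: "pvar n * As e v = As e (pvar n * v)"
  by (simp add: As_def at_var_def sum_distrib_left pvar_A_series if_distrib cong: if_cong)

lemma pdiff_Bs: "pdiff n (Bs e v) = Bs e (pdiff n v)"
  unfolding Bs_def linear_op_sum[OF linear_op_pdiff]
  by (simp add: at_var_def pdiff_B_series if_distrib cong: if_cong)

lemma pvar_Bs:
  assumes "odd n"
  shows "pvar n * Bs e v = Bs e (pvar n * v) +
    (\<Sum>i=1..r. scal (if e = Poly_Mapping.single i (- int n) then beta (t i) n else 0) v)"
  unfolding Bs_def sum_distrib_left
  by (simp only: at_var_comm[OF linear_op_pvar pvar_B_series[OF assms]] sum.distrib)

lemma normal_Y_eq: "normal_Y r t = op_times (op_exp As) (op_exp Bs)"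
  by (simp add: normal_Y_def As_def [abs_def] Bs_def [abs_def])

lemma linear_exp_As: "linear_op (op_exp As e)"
  and linear_exp_Bs: "linear_op (op_exp Bs e)"
  by (rule linear_op_exp[OF exponentiable_As] linear_op_exp[OF exponentiable_Bs])+

lemma exp_Bs_1: "op_exp Bs e 1 = op_one e 1"
  by (rule op_exp_vacuum[OF exponentiable_Bs]) (simp add: Bs_def at_var_def B_series_1 cong: if_cong)

lemma pvar_exp_Bs:
  "odd n \<Longrightarrow> shift_comm ((*) (pvar n)) {1..r} (\<lambda>i. Poly_Mapping.single i (- int n)) (\<lambda>i. beta (t i) n) (op_exp Bs)"
  by (rule shift_comm_exp[OF exponentiable_Bs]) (simp_all add: linear_op_pvar pvar_Bs)

lemma composable_exp_As_exp_Bs: "composable (op_exp As) (op_exp Bs)"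
proof (rule composable_of_vacuum[where I = "{1..r}"])
  fix e
  have "{k. op_exp As k \<noteq> (\<lambda>_. 0) \<and> op_exp Bs (e - k) 1 \<noteq> 0} \<subseteq> {e}"
    by (auto simp: exp_Bs_1 op_one_def split: if_splits)
  then show "finite {k. op_exp As k \<noteq> (\<lambda>_. 0) \<and> op_exp Bs (e - k) 1 \<noteq> 0}"
    by (rule finite_subset) simp
qed (auto simp: linear_exp_Bs simp del: One_nat_def intro: pvar_exp_Bs)

lemma linear_normal_Y: "linear_op (normal_Y r t e)"
  unfolding normal_Y_eq
  by (intro linear_op_times linear_exp_As linear_exp_Bs composable_exp_As_exp_Bs)

lemma pdiff_normal_Y:
  assumes "odd n"
  shows "shift_comm (pdiff n) {1..r} (\<lambda>i. Poly_Mapping.single i (int n)) (\<lambda>i. alpha (t i) n) (normal_Y r t)"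
proof -
  have "shift_comm (pdiff n) {1..r} (\<lambda>i. Poly_Mapping.single i (int n)) (\<lambda>i. alpha (t i) n) (op_exp As)"
    by (rule shift_comm_exp[OF exponentiable_As]) (simp_all add: linear_op_pdiff pdiff_As assms)
  moreover have "shift_comm (pdiff n) {1..r} (\<lambda>i. Poly_Mapping.single i (int n)) (\<lambda>_. 0) (op_exp Bs)"
    by (rule shift_comm_exp[OF exponentiable_Bs]) (simp_all add: linear_op_pdiff pdiff_Bs)
  ultimately have "shift_comm (pdiff n) {1..r} (\<lambda>i. Poly_Mapping.single i (int n))
      (\<lambda>i. alpha (t i) n + 0) (normal_Y r t)"
    unfolding normal_Y_eq
    by (intro shift_comm_times linear_op_pdiff linear_exp_As linear_exp_Bs composable_exp_As_exp_Bs) simp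
  then show ?thesis by simp
qed

lemma pvar_normal_Y:
  assumes "odd n"
  shows "shift_comm ((*) (pvar n)) {1..r} (\<lambda>i. Poly_Mapping.single i (- int n)) (\<lambda>i. beta (t i) n) (normal_Y r t)"
proof -
  have "shift_comm ((*) (pvar n)) {1..r} (\<lambda>i. Poly_Mapping.single i (- int n)) (\<lambda>_. 0) (op_exp As)"
    by (rule shift_comm_exp[OF exponentiable_As]) (simp_all add: linear_op_pvar pvar_As)
  then have "shift_comm ((*) (pvar n)) {1..r} (\<lambda>i. Poly_Mapping.single i (- int n))
      (\<lambda>i. 0 + beta (t i) n) (normal_Y r t)"
    unfolding normal_Y_eq
    by (intro shift_comm_times linear_op_pvar linear_exp_As linear_exp_Bs composable_exp_As_exp_Bs
        pvar_exp_Bs assms) simp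
  then show ?thesis by simp
qed

lemma normal_Y_1: "normal_Y r t e 1 = op_exp As e 1"
proof -
  have "normal_Y r t e 1 = (\<Sum>k\<in>{e}. op_exp As k (op_exp Bs (e - k) 1))"
    unfolding normal_Y_eq
    by (rule op_times_eq_sum) (auto simp: linear_exp_As exp_Bs_1 op_one_def split: if_splits)
  then show ?thesis by (simp add: exp_Bs_1 op_one_def)
qed

lemma const_term_normal_Y_1: "const_term (normal_Y r t e 1) = (if e = 0 then 1 else 0)"
proof -
  have "const_term (As e v) = 0" for e v
    by (simp add: As_def at_var_def lookup_sum const_term_A_series if_distrib[of const_term] cong: if_cong)
  then have "const_term (op_exp As e 1) = const_term (op_one e 1)"
    by (rule op_exp_covacuum[OF exponentiable_As])
  then show ?thesis by (simp add: normal_Y_1 op_one_def)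
qed

lemma normal_Y_1_support:
  assumes "normal_Y r t e 1 \<noteq> 0"
  shows "0 \<le> Poly_Mapping.lookup e i"
proof -
  have "e \<in> {e. \<forall>i. 0 \<le> Poly_Mapping.lookup e i}"
  proof (rule op_exp_support[OF exponentiable_As])
    show "op_exp As e 1 \<noteq> 0" using assms by (simp add: normal_Y_1)
  qed (auto elim!: As_nonzero simp: lookup_add lookup_single when_def)
  then show ?thesis by simp
qed

end

section \<open>The contraction factors\<close>

lemma F_fps_0: "fps_nth (F_fps t s) 0 = 1"
  by (simp add: F_fps_def fps_compose_nth_0)

text \<open>The differential equation \<open>u F'(u) = - (\<Sum>l odd. gamma t s l u\<^sup>l) F(u)\<close> in coefficients; the sum may stop
  at any \<open>N \<ge> n\<close>.\<close>

lemma F_fps_rec: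
  assumes "n \<le> N"
  shows "- of_nat n * fps_nth (F_fps t s) n =
    (\<Sum>l | l \<le> N \<and> odd l. gamma t s l * (if l \<le> n then fps_nth (F_fps t s) (n - l) else 0))"
proof -
  define g :: "'a fps" where "g = fps_const (- 2) *
      Abs_fps (\<lambda>n. if odd n then (1 - s ^ n) / (1 - t ^ n) * (1 / of_nat n) else 0)"
  define F where "F = F_fps t s"
  have g: "of_nat l * fps_nth g l = (if odd l then - gamma t s l else 0)" for l
    by (cases "l = 0") (auto simp: g_def gamma_def)
  have "fps_deriv F = F * fps_deriv g"
    unfolding F_def F_fps_def g_def[symmetric]
    by (subst fps_compose_deriv) (simp_all add: g_def)
  note deriv = this
  have rec: "of_nat (Suc k) * fps_nth F (Suc k) =
      (\<Sum>i\<le>k. of_nat (Suc i) * fps_nth g (Suc i) * fps_nth F (k - i))" for k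
  proof -
    have "fps_nth (fps_deriv F) k = fps_nth (fps_deriv g * F) k"
      unfolding deriv by (rule arg_cong[OF mult.commute, of "\<lambda>f. fps_nth f k"])
    then show ?thesis by (simp add: fps_mult_nth atLeast0AtMost del: of_nat_Suc)
  qed
  have "of_nat n * fps_nth F n = (\<Sum>l\<le>n. of_nat l * fps_nth g l * fps_nth F (n - l))"
    by (cases n) (simp_all add: rec sum.atMost_Suc_shift del: of_nat_Suc sum.atMost_Suc)
  also have "\<dots> = (\<Sum>l | l \<le> N \<and> odd l. - (gamma t s l * (if l \<le> n then fps_nth F (n - l) else 0)))"
    using assms by (intro sum.mono_neutral_cong) (auto simp: g)
  finally show ?thesis unfolding F_def[symmetric] by (simp add: sum_negf)
qed

lemma at_ratio_eq:
  assumes "i \<noteq> j" and "e = Poly_Mapping.single j (int n) - Poly_Mapping.single i (int n)"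
  shows "at_ratio j i F e v = scal (fps_nth F n) v"
  using assms by (simp add: at_ratio_def lookup_minus lookup_single)

lemma at_ratio_nonzero:
  assumes "at_ratio j i F e v \<noteq> 0"
  obtains n where "e = Poly_Mapping.single j (int n) - Poly_Mapping.single i (int n)"
proof -
  have "e = Poly_Mapping.single j (Poly_Mapping.lookup e j) - Poly_Mapping.single i (Poly_Mapping.lookup e j)"
    "Poly_Mapping.lookup e j \<ge> 0"
    using assms by (auto simp: at_ratio_def Let_def split: if_splits)
  then show ?thesis using that[of "nat (Poly_Mapping.lookup e j)"] by simp
qed

text \<open>The same equation for \<open>F(z\<^sub>j/z\<^sub>i)\<close>, differentiated with respect to \<open>z\<^sub>i\<close>.\<close>

lemma euler_at_ratio:
  assumes ij: "i \<noteq> j" and N: "- Poly_Mapping.lookup e i \<le> int N"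
  shows "scal (of_int (Poly_Mapping.lookup e i)) (at_ratio j i (F_fps t s) e v) =
    (\<Sum>l | l \<le> N \<and> odd l. scal (gamma t s l) (at_ratio j i (F_fps t s)
       (e + (Poly_Mapping.single i (int l) - Poly_Mapping.single j (int l))) v))"
proof (cases "\<exists>n. e = Poly_Mapping.single j (int n) - Poly_Mapping.single i (int n)")
  case True
  then obtain n where e: "e = Poly_Mapping.single j (int n) - Poly_Mapping.single i (int n)" by blast
  have "n \<le> N" using N ij by (simp add: e lookup_minus lookup_single)
  have "at_ratio j i (F_fps t s) (e + (Poly_Mapping.single i (int l) - Poly_Mapping.single j (int l))) v =
      scal (if l \<le> n then fps_nth (F_fps t s) (n - l) else 0) v" for l
  proof (cases "l \<le> n")
    case True
    have "at_ratio j i (F_fps t s) (e + (Poly_Mapping.single i (int l) - Poly_Mapping.single j (int l))) v =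
        scal (fps_nth (F_fps t s) (n - l)) v"
      using True by (intro at_ratio_eq ij) (simp add: e of_nat_diff single_diff)
    then show ?thesis using True by simp
  next
    case False
    then show ?thesis using ij by (simp add: at_ratio_def e lookup_add lookup_minus lookup_single)
  qed
  then have "(\<Sum>l | l \<le> N \<and> odd l. scal (gamma t s l) (at_ratio j i (F_fps t s)
       (e + (Poly_Mapping.single i (int l) - Poly_Mapping.single j (int l))) v)) =
      scal (- of_nat n * fps_nth (F_fps t s) n) v"
    unfolding F_fps_rec[OF \<open>n \<le> N\<close>] by (simp only: scal_sum_left scal_scal)
  moreover have "Poly_Mapping.lookup e i = - int n"
    using ij by (simp add: e lookup_minus lookup_single)
  ultimately show ?thesis
    by (simp add: at_ratio_eq[OF ij e])
next
  case False
  have "at_ratio j i (F_fps t s) (e + (Poly_Mapping.single i (int l) - Poly_Mapping.single j (int l))) v = 0" for l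
  proof (rule ccontr)
    assume "\<not> ?thesis"
    then obtain n where n: "e + (Poly_Mapping.single i (int l) - Poly_Mapping.single j (int l)) =
        Poly_Mapping.single j (int n) - Poly_Mapping.single i (int n)"
      by (rule at_ratio_nonzero)
    have "e = (e + (Poly_Mapping.single i (int l) - Poly_Mapping.single j (int l))) -
       (Poly_Mapping.single i (int l) - Poly_Mapping.single j (int l))" by simp
    then have "e = Poly_Mapping.single j (int (n + l)) - Poly_Mapping.single i (int (n + l))"
      by (simp only: n) (simp add: single_add)
    then show False using False by blast
  qed
  moreover have "at_ratio j i (F_fps t s) e v = 0"
    using False at_ratio_nonzero by blast
  ultimately show ?thesis by simp
qed

text \<open>Series whose coefficients are scalars, acting by multiplication.\<close>

definition scalar_series :: "('e::ab_group_add, 'a::field_char_0) op_series \<Rightarrow> bool" where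
  "scalar_series X \<longleftrightarrow> (\<exists>c. \<forall>e v. X e v = scal (c e) v)"

lemma scalar_series_linear: "scalar_series X \<Longrightarrow> linear_op (X e)"
  by (auto simp: scalar_series_def linear_op_def scal_add mult.commute)

lemma scalar_series_shift_comm:
  "scalar_series X \<Longrightarrow> linear_op D \<Longrightarrow> shift_comm D I s (\<lambda>_. 0) X"
  by (auto simp: scalar_series_def shift_comm_def linear_op_scal)

lemma scalar_series_const_term:
  assumes "scalar_series X"
  shows "const_term (X e v) = const_term (X e 1) * const_term v"
  using assms by (auto simp: scalar_series_def lookup_scal)

lemma scalar_series_nonzero:
  assumes "scalar_series X" "X e \<noteq> (\<lambda>_. 0)"
  shows "X e 1 \<noteq> 0"
proof
  assume *: "X e 1 = 0"
  obtain c where c: "\<And>e v. X e v = scal (c e) v" using assms(1) by (auto simp: scalar_series_def)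
  have "const_term (X e 1) = c e" by (simp add: c lookup_scal)
  then have "c e = 0" using * by simp
  then show False using assms(2) c by auto
qed

lemma scalar_series_times:
  assumes X: "scalar_series X" and Y: "scalar_series Y" and XY: "composable X Y"
  shows "scalar_series (op_times X Y)"
proof -
  obtain c where c: "\<And>e v. X e v = scal (c e) v" using X by (auto simp: scalar_series_def)
  obtain d where d: "\<And>e v. Y e v = scal (d e) v" using Y by (auto simp: scalar_series_def)
  define K where "K e = {k. X k \<noteq> (\<lambda>_. 0) \<and> Y (e - k) 1 \<noteq> 0}" for e
  have "op_times X Y e v = scal (\<Sum>k\<in>K e. c k * d (e - k)) v" for e v
  proof -
    have "Y f 1 \<noteq> 0" if "Y f v \<noteq> 0" for f
      by (rule scalar_series_nonzero[OF Y]) (use that in auto)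
    then have "{k. X k \<noteq> (\<lambda>_. 0) \<and> Y (e - k) v \<noteq> 0} \<subseteq> K e"
      by (auto simp: K_def)
    moreover have "finite (K e)" using XY by (simp add: K_def composable_def)
    ultimately have "op_times X Y e v = (\<Sum>k\<in>K e. X k (Y (e - k) v))"
      by (intro op_times_eq_sum scalar_series_linear X)
    then show ?thesis by (simp add: c d scal_sum_left)
  qed
  then show ?thesis
    unfolding scalar_series_def by (intro exI[of _ "\<lambda>e. \<Sum>k\<in>K e. c k * d (e - k)"] allI)
qed

lemma scalar_series_one: "scalar_series op_one"
  unfolding scalar_series_def op_one_def by (rule exI[of _ "\<lambda>e. if e = 0 then 1 else 0"]) simp

lemma scalar_series_at_ratio: "scalar_series (at_ratio j i F)"
proof -
  define c where "c e = (let n = Poly_Mapping.lookup e j in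
      if n \<ge> 0 \<and> e = Poly_Mapping.single j n - Poly_Mapping.single i n
      then fps_nth F (nat n) else 0)" for e :: "nat \<Rightarrow>\<^sub>0 int"
  have "at_ratio j i F e v = scal (c e) v" for e v
    by (simp only: at_ratio_def c_def Let_def if_distrib[of "\<lambda>x. scal x v"] scal_0_left)
  then show ?thesis unfolding scalar_series_def by blast
qed

text \<open>For an additive weight \<open>u\<close> of exponents, multiplying each coefficient by the weight of its exponent
  is a derivation (such as \<open>z\<^sub>m \<partial>/\<partial>z\<^sub>m\<close>).  So the logarithmic derivatives of two factors add up.  The equations
  are only required for weights at least \<open>-N\<close>, where their sums have been cut off; this suffices since
  both factors live in nonpositive weights.\<close>

lemma euler_times:
  fixes X Y :: "('e::ab_group_add, 'a::field_char_0) op_series" and u :: "'e \<Rightarrow> int"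
  assumes X: "\<And>k. linear_op (X k)" and XY: "composable X Y"
    and P: "finite P" and P': "finite P'"
    and u: "\<And>e f. u (e + f) = u e + u f"
    and uX: "\<And>k. X k \<noteq> (\<lambda>_. 0) \<Longrightarrow> u k \<le> 0" and uY: "\<And>f. Y f v \<noteq> 0 \<Longrightarrow> u f \<le> 0"
    and eX: "\<And>k w. - u k \<le> N \<Longrightarrow> scal (of_int (u k)) (X k w) = (\<Sum>p\<in>P. scal (c p) (X (k + q p) w))"
    and eY: "\<And>f. - u f \<le> N \<Longrightarrow> scal (of_int (u f)) (Y f v) = (\<Sum>p\<in>P'. scal (c' p) (Y (f + q' p) v))"
    and N: "- u e \<le> N"
  shows "scal (of_int (u e)) (op_times X Y e v) =
    (\<Sum>p\<in>P. scal (c p) (op_times X Y (e + q p) v)) + (\<Sum>p\<in>P'. scal (c' p) (op_times X Y (e + q' p) v))"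
proof -
  define S where "S e = {k. X k \<noteq> (\<lambda>_. 0) \<and> Y (e - k) v \<noteq> 0}" for e
  have fin: "finite (S e)" for e
    using XY by (simp add: S_def composable_def)
  have eq: "op_times X Y e v = (\<Sum>k\<in>K. X k (Y (e - k) v))" if "finite K" "S e \<subseteq> K" for e K
    using op_times_eq_sum[OF X that(1)] that(2) by (simp add: S_def)
  define K where "K = S e \<union> (\<Union>p\<in>P. (\<lambda>k. k - q p) ` S (e + q p)) \<union> (\<Union>p\<in>P'. S (e + q' p))"
  have finK: "finite K" using P P' fin by (simp add: K_def)
  have split_u: "u e = u k + u (e - k)" for k
    using u[of k "e - k"] by simp
  have left: "scal (of_int (u k)) (X k (Y (e - k) v)) =
      (\<Sum>p\<in>P. scal (c p) (X (k + q p) (Y (e - k) v)))" for k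
  proof (cases "Y (e - k) v = 0")
    case True
    then show ?thesis by (simp add: linear_op_0[OF X])
  next
    case False
    then have "- u k \<le> N" using uY[of "e - k"] split_u[of k] N by linarith
    then show ?thesis by (rule eX)
  qed
  have right: "scal (of_int (u (e - k))) (X k (Y (e - k) v)) =
      (\<Sum>p\<in>P'. scal (c' p) (X k (Y (e - k + q' p) v)))" for k
  proof (cases "X k = (\<lambda>_. 0)")
    case True
    then show ?thesis by simp
  next
    case False
    then have "- u (e - k) \<le> N" using uX[of k] split_u[of k] N by linarith
    then have "X k (scal (of_int (u (e - k))) (Y (e - k) v)) =
        X k (\<Sum>p\<in>P'. scal (c' p) (Y (e - k + q' p) v))" by (simp only: eY)
    then show ?thesis by (simp add: linear_op_scal[OF X] linear_op_sum[OF X])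
  qed
  have shifted: "(\<Sum>k\<in>K. X (k + q p) (Y (e - k) v)) = op_times X Y (e + q p) v" if "p \<in> P" for p
  proof -
    have "S (e + q p) \<subseteq> (\<lambda>k. k + q p) ` K"
    proof
      fix k assume "k \<in> S (e + q p)"
      then have "k - q p \<in> K" using that by (auto simp: K_def)
      then show "k \<in> (\<lambda>k. k + q p) ` K" by (rule rev_image_eqI) simp
    qed
    then have "op_times X Y (e + q p) v = (\<Sum>k\<in>(\<lambda>k. k + q p) ` K. X k (Y (e + q p - k) v))"
      using finK by (intro eq) auto
    also have "\<dots> = (\<Sum>k\<in>K. X (k + q p) (Y (e - k) v))"
      by (subst sum.reindex) (auto simp: inj_on_def)
    finally show ?thesis by simp
  qed
  have shifted': "(\<Sum>k\<in>K. X k (Y (e - k + q' p) v)) = op_times X Y (e + q' p) v" if "p \<in> P'" for p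
  proof -
    have swap: "e - k + q' p = e + q' p - k" for k by simp
    show ?thesis unfolding swap
      using finK that by (intro eq[symmetric]) (auto simp: K_def)
  qed
  have "scal (of_int (u e)) (op_times X Y e v) = (\<Sum>k\<in>K. scal (of_int (u e)) (X k (Y (e - k) v)))"
    using finK by (subst eq[of K]) (auto simp: K_def scal_sum)
  also have "\<dots> = (\<Sum>k\<in>K. scal (of_int (u k)) (X k (Y (e - k) v)) + scal (of_int (u (e - k))) (X k (Y (e - k) v)))"
    by (intro sum.cong refl) (simp add: split_u[symmetric] flip: scal_add_left of_int_add)
  also have "\<dots> = (\<Sum>p\<in>P. scal (c p) (\<Sum>k\<in>K. X (k + q p) (Y (e - k) v))) +
      (\<Sum>p\<in>P'. scal (c' p) (\<Sum>k\<in>K. X k (Y (e - k + q' p) v)))"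
    by (simp add: left right sum.distrib scal_sum sum.swap[of _ P K] sum.swap[of _ P' K])
  finally show ?thesis by (simp add: shifted shifted')
qed

text \<open>The product of the factors \<open>F(z\<^sub>j/z\<^sub>m)\<close> for \<open>j\<close> in a list, multiplied by a further series \<open>Q\<close>.\<close>

definition Fs_from :: "(nat \<Rightarrow> 'a::field_char_0) \<Rightarrow> nat \<Rightarrow> nat list \<Rightarrow>
    (nat \<Rightarrow>\<^sub>0 int, 'a) op_series \<Rightarrow> (nat \<Rightarrow>\<^sub>0 int, 'a) op_series" where
  "Fs_from t m js Q = foldr op_times (map (\<lambda>j. at_ratio j m (F_fps (t m) (t j))) js) Q"

text \<open>The support condition that makes all the products of contraction factors finite: exponents of total
  degree \<open>0\<close> that only involve \<open>z\<^sub>m, \<dots>, z\<^sub>r\<close>, with a nonpositive exponent of \<open>z\<^sub>m\<close>.\<close>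

definition cone_supported :: "nat \<Rightarrow> nat \<Rightarrow> (nat \<Rightarrow>\<^sub>0 int, 'a::field_char_0) op_series \<Rightarrow> bool" where
  "cone_supported r m X \<longleftrightarrow> (\<forall>e v. X e v \<noteq> 0 \<longrightarrow>
     height r e = 0 \<and> (\<forall>l. l < m \<or> r < l \<longrightarrow> Poly_Mapping.lookup e l = 0) \<and> Poly_Mapping.lookup e m \<le> 0)"

text \<open>All the properties are proved in one induction on the list, since the finiteness of each product
  rests on the support of the preceding one.  The factor \<open>Q\<close> does not involve \<open>z\<^sub>m\<close>, so it is recovered at
  exponent \<open>0\<close> of \<open>z\<^sub>m\<close> and does not contribute to the logarithmic derivative.\<close>

lemma Fs_from_props:
  fixes t :: "nat \<Rightarrow> 'a::field_char_0"
  assumes Q: "scalar_series Q" "cone_supported r m Q" "\<And>e v. Q e v \<noteq> 0 \<Longrightarrow> Poly_Mapping.lookup e m = 0"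
    and m: "1 \<le> m" "m \<le> r" and js: "distinct js" "set js \<subseteq> {Suc m..r}"
  shows "scalar_series (Fs_from t m js Q) \<and> cone_supported r m (Fs_from t m js Q) \<and>
    (\<forall>e v. Poly_Mapping.lookup e m = 0 \<longrightarrow> Fs_from t m js Q e v = Q e v) \<and>
    (\<forall>e v N. - Poly_Mapping.lookup e m \<le> int N \<longrightarrow>
      scal (of_int (Poly_Mapping.lookup e m)) (Fs_from t m js Q e v) =
      (\<Sum>l | l \<le> N \<and> odd l. \<Sum>j\<in>set js. scal (gamma (t m) (t j) l) (Fs_from t m js Q
         (e + (Poly_Mapping.single m (int l) - Poly_Mapping.single j (int l))) v)))"
  using js
proof (induction js)
  case Nil
  have "scal (of_int (Poly_Mapping.lookup e m)) (Q e v) = 0" for e v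
    using Q(3)[of e v] by (cases "Q e v = 0") auto
  then show ?case using Q by (simp add: Fs_from_def)
next
  case (Cons j js)
  define X where "X = at_ratio j m (F_fps (t m) (t j))"
  define Y where "Y = Fs_from t m js Q"
  have j: "m \<noteq> j" "j \<in> {1..r}" "m \<in> {1..r}" "j > m" using Cons.prems m by auto
  have rec: "Fs_from t m (j # js) Q = op_times X Y" by (simp add: Fs_from_def X_def Y_def)
  have IH: "scalar_series Y" "cone_supported r m Y"
    "\<And>e v. Poly_Mapping.lookup e m = 0 \<Longrightarrow> Y e v = Q e v"
    "\<And>e v N. - Poly_Mapping.lookup e m \<le> int N \<Longrightarrow> scal (of_int (Poly_Mapping.lookup e m)) (Y e v) =
      (\<Sum>l | l \<le> N \<and> odd l. \<Sum>j\<in>set js. scal (gamma (t m) (t j) l) (Y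
         (e + (Poly_Mapping.single m (int l) - Poly_Mapping.single j (int l))) v))"
    using Cons unfolding Y_def by auto
  have X: "scalar_series X" by (simp add: X_def scalar_series_at_ratio)
  note linX = scalar_series_linear[OF X]
  have Xnz: "\<exists>n. k = Poly_Mapping.single j (int n) - Poly_Mapping.single m (int n)"
    if "X k \<noteq> (\<lambda>_. 0)" for k
    using that unfolding X_def by (metis at_ratio_nonzero)
  have Ynz: "height r f = 0" "\<And>l. l < m \<or> r < l \<Longrightarrow> Poly_Mapping.lookup f l = 0" "Poly_Mapping.lookup f m \<le> 0"
    if "Y f v \<noteq> 0" for f v
    using IH(2) that unfolding cone_supported_def by blast+
  \<comment> \<open>The exponent of \<open>z\<^sub>m\<close> is \<open>-n\<close> in the first factor and nonpositive in the second.\<close>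
  have "{k. X k \<noteq> (\<lambda>_. 0) \<and> Y (e - k) v \<noteq> 0} \<subseteq>
      (\<lambda>n. Poly_Mapping.single j (int n) - Poly_Mapping.single m (int n)) ` {..nat (- Poly_Mapping.lookup e m)}" for e v
  proof
    fix k assume k: "k \<in> {k. X k \<noteq> (\<lambda>_. 0) \<and> Y (e - k) v \<noteq> 0}"
    then obtain n where n: "k = Poly_Mapping.single j (int n) - Poly_Mapping.single m (int n)"
      using Xnz by blast
    have "Poly_Mapping.lookup (e - k) m \<le> 0" using k Ynz by blast
    then have "n \<le> nat (- Poly_Mapping.lookup e m)"
      using j by (simp add: n lookup_minus lookup_single)
    then show "k \<in> (\<lambda>n. Poly_Mapping.single j (int n) - Poly_Mapping.single m (int n)) ` {..nat (- Poly_Mapping.lookup e m)}"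
      using n by blast
  qed
  then have XY: "composable X Y"
    unfolding composable_def by (meson finite_atMost finite_imageI finite_subset)
  have "scalar_series (op_times X Y)" by (intro scalar_series_times X IH XY)
  moreover have "cone_supported r m (op_times X Y)"
    unfolding cone_supported_def
  proof (intro allI impI)
    fix e v assume "op_times X Y e v \<noteq> 0"
    then obtain k where k: "X k \<noteq> (\<lambda>_. 0)" "Y (e - k) v \<noteq> 0"
      using op_times_eq_0[of X Y e v, OF linX] by blast
    obtain n where n: "k = Poly_Mapping.single j (int n) - Poly_Mapping.single m (int n)"
      using Xnz k(1) by blast
    have "height r (e - k) = height r e"
      using j by (simp add: n height_def lookup_minus sum_subtractf lookup_single when_def)
    then have "height r e = 0" using Ynz(1)[OF k(2)] by simp
    moreover have "Poly_Mapping.lookup e l = 0" if "l < m \<or> r < l" for l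
      using Ynz(2)[OF k(2) that] that j by (auto simp: n lookup_minus lookup_single when_def)
    moreover have "Poly_Mapping.lookup e m \<le> 0"
      using Ynz(3)[OF k(2)] j by (simp add: n lookup_minus lookup_single)
    ultimately show "height r e = 0 \<and> (\<forall>l. l < m \<or> r < l \<longrightarrow> Poly_Mapping.lookup e l = 0) \<and>
        Poly_Mapping.lookup e m \<le> 0" by blast
  qed
  moreover have "op_times X Y e v = Q e v" if "Poly_Mapping.lookup e m = 0" for e v
  proof -
    have "op_times X Y e v = (\<Sum>k\<in>{0}. X k (Y (e - k) v))"
    proof (rule op_times_eq_sum[OF linX])
      show "{k. X k \<noteq> (\<lambda>_. 0) \<and> Y (e - k) v \<noteq> 0} \<subseteq> {0}"
      proof
        fix k assume k: "k \<in> {k. X k \<noteq> (\<lambda>_. 0) \<and> Y (e - k) v \<noteq> 0}"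
        then obtain n where n: "k = Poly_Mapping.single j (int n) - Poly_Mapping.single m (int n)"
          using Xnz by blast
        have "Poly_Mapping.lookup (e - k) m \<le> 0" using k Ynz by blast
        then show "k \<in> {0}" using j that by (simp add: n lookup_minus lookup_single)
      qed
    qed simp
    also have "\<dots> = Y e v"
      using at_ratio_eq[OF j(1), of 0 0 "F_fps (t m) (t j)" "Y e v"] by (simp add: X_def F_fps_0)
    finally show ?thesis using IH(3)[OF that] by simp
  qed
  moreover have "scal (of_int (Poly_Mapping.lookup e m)) (op_times X Y e v) =
      (\<Sum>l | l \<le> N \<and> odd l. \<Sum>j\<in>set (j # js). scal (gamma (t m) (t j) l) (op_times X Y
         (e + (Poly_Mapping.single m (int l) - Poly_Mapping.single j (int l))) v))"
    if N: "- Poly_Mapping.lookup e m \<le> int N" for e v N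
  proof -
    let ?O = "{l. l \<le> N \<and> odd l}"
    have "scal (of_int (Poly_Mapping.lookup e m)) (op_times X Y e v) =
        (\<Sum>l\<in>?O. scal (gamma (t m) (t j) l) (op_times X Y
          (e + (Poly_Mapping.single m (int l) - Poly_Mapping.single j (int l))) v)) +
        (\<Sum>(l, j)\<in>?O \<times> set js. scal (gamma (t m) (t j) l) (op_times X Y
          (e + (Poly_Mapping.single m (int l) - Poly_Mapping.single j (int l))) v))"
      unfolding case_prod_beta
    proof (rule euler_times[where N = "int N"])
      show "Poly_Mapping.lookup k m \<le> 0" if "X k \<noteq> (\<lambda>_. 0)" for k
        using Xnz[OF that] j by (auto simp: lookup_minus lookup_single)
      show "Poly_Mapping.lookup f m \<le> 0" if "Y f v \<noteq> 0" for f
        using Ynz that by blast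
      show "scal (of_int (Poly_Mapping.lookup k m)) (X k w) = (\<Sum>l\<in>?O. scal (gamma (t m) (t j) l)
          (X (k + (Poly_Mapping.single m (int l) - Poly_Mapping.single j (int l))) w))"
        if "- Poly_Mapping.lookup k m \<le> int N" for k w
        unfolding X_def using j(1) that by (rule euler_at_ratio)
      show "scal (of_int (Poly_Mapping.lookup f m)) (Y f v) = (\<Sum>p\<in>?O \<times> set js.
          scal (gamma (t m) (t (snd p)) (fst p))
            (Y (f + (Poly_Mapping.single m (int (fst p)) - Poly_Mapping.single (snd p) (int (fst p)))) v))"
        if "- Poly_Mapping.lookup f m \<le> int N" for f
        using IH(4)[OF that, of v] by (simp add: sum.cartesian_product case_prod_beta)
    qed (use linX XY N in \<open>simp_all add: lookup_add\<close>)
    then show ?thesis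
      using Cons.prems by (simp add: sum.distrib sum.cartesian_product)
  qed
  ultimately show ?case unfolding rec by blast
qed

text \<open>The product of the factors \<open>F(z\<^sub>j/z\<^sub>i)\<close> over \<open>m \<le> i < j \<le> r\<close>.\<close>

definition Fs :: "(nat \<Rightarrow> 'a::field_char_0) \<Rightarrow> nat \<Rightarrow> nat \<Rightarrow> (nat \<Rightarrow>\<^sub>0 int, 'a) op_series" where
  "Fs t r m = op_prod [at_ratio j i (F_fps (t i) (t j)). i \<leftarrow> [m..<Suc r], j \<leftarrow> [Suc i..<Suc r]]"

lemma Fs_Suc_r: "Fs t r (Suc r) = op_one"
  by (simp add: Fs_def op_prod_def)

lemma Fs_rec: "m \<le> r \<Longrightarrow> Fs t r m = Fs_from t m [Suc m..<Suc r] (Fs t r (Suc m))"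
  by (simp add: Fs_def op_prod_def upt_conv_Cons Fs_from_def del: upt_Suc)

lemma Fs_step_props:
  fixes t :: "nat \<Rightarrow> 'a::field_char_0"
  assumes m: "1 \<le> m" "m \<le> r"
    and Q: "scalar_series (Fs t r (Suc m))" "cone_supported r (Suc m) (Fs t r (Suc m))"
  shows "scalar_series (Fs t r m) \<and> cone_supported r m (Fs t r m) \<and>
    (\<forall>e v. Poly_Mapping.lookup e m = 0 \<longrightarrow> Fs t r m e v = Fs t r (Suc m) e v) \<and>
    (\<forall>e v N. - Poly_Mapping.lookup e m \<le> int N \<longrightarrow>
      scal (of_int (Poly_Mapping.lookup e m)) (Fs t r m e v) =
      (\<Sum>l | l \<le> N \<and> odd l. \<Sum>j\<in>{Suc m..r}. scal (gamma (t m) (t j) l) (Fs t r m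
         (e + (Poly_Mapping.single m (int l) - Poly_Mapping.single j (int l))) v)))"
proof -
  have zero: "Poly_Mapping.lookup e m = 0" if "Fs t r (Suc m) e v \<noteq> 0" for e v
    using Q(2) that by (auto simp: cone_supported_def)
  then have cone: "cone_supported r m (Fs t r (Suc m))"
    using Q(2) by (auto simp: cone_supported_def)
  have set: "set [Suc m..<Suc r] = {Suc m..r}" by (simp only: set_upt atLeastLessThanSuc_atLeastAtMost)
  have "set [Suc m..<Suc r] \<subseteq> {Suc m..r}" by (simp only: set order_refl)
  from Fs_from_props[OF Q(1) cone zero m distinct_upt this, where t = t]
  show ?thesis
    unfolding set Fs_rec[OF m(2), symmetric] .
qed

lemma Fs_props:
  "m \<le> Suc r \<Longrightarrow> 1 \<le> m \<Longrightarrow> scalar_series (Fs t r m) \<and> cone_supported r m (Fs t r m)"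
proof (induction m rule: inc_induct)
  case base
  have "cone_supported r (Suc r) (op_one :: (nat \<Rightarrow>\<^sub>0 int, 'a) op_series)"
    by (simp add: cone_supported_def op_one_def height_def)
  then show ?case
    unfolding Fs_Suc_r using scalar_series_one by blast
next
  case (step m)
  then have "1 \<le> m" "m \<le> r" "1 \<le> Suc m" by simp_all
  then show ?case
    using Fs_step_props[of m r t] step.IH by blast
qed

lemma Fs_step:
  assumes m: "1 \<le> m" "m \<le> r"
  shows "Poly_Mapping.lookup e m = 0 \<Longrightarrow> Fs t r m e v = Fs t r (Suc m) e v"
    and "- Poly_Mapping.lookup e m \<le> int N \<Longrightarrow>
      scal (of_int (Poly_Mapping.lookup e m)) (Fs t r m e v) =
      (\<Sum>l | l \<le> N \<and> odd l. \<Sum>j\<in>{Suc m..r}. scal (gamma (t m) (t j) l) (Fs t r m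
         (e + (Poly_Mapping.single m (int l) - Poly_Mapping.single j (int l))) v))"
proof -
  have "1 \<le> Suc m" "Suc m \<le> Suc r" using m by simp_all
  then have Q: "scalar_series (Fs t r (Suc m))" "cone_supported r (Suc m) (Fs t r (Suc m))"
    using Fs_props by blast+
  note props = Fs_step_props[OF m Q]
  show "Poly_Mapping.lookup e m = 0 \<Longrightarrow> Fs t r m e v = Fs t r (Suc m) e v"
    using props by blast
  show "- Poly_Mapping.lookup e m \<le> int N \<Longrightarrow>
      scal (of_int (Poly_Mapping.lookup e m)) (Fs t r m e v) =
      (\<Sum>l | l \<le> N \<and> odd l. \<Sum>j\<in>{Suc m..r}. scal (gamma (t m) (t j) l) (Fs t r m
         (e + (Poly_Mapping.single m (int l) - Poly_Mapping.single j (int l))) v))"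
    using props by blast
qed

section \<open>Comparison of both sides\<close>

text \<open>The vacuum expectation value of the product of vertex operators and the product of contraction
  factors satisfy the same differential equation in \<open>z\<^sub>m\<close>, vanish at positive exponents of \<open>z\<^sub>m\<close>, and agree at
  exponent \<open>0\<close> by induction on \<open>m\<close>.  At negative exponents, the equation is a recursion that determines
  them, because the characteristic is \<open>0\<close>.\<close>

lemma const_term_Ys_eq_Fs:
  fixes t :: "nat \<Rightarrow> 'a::field_char_0"
  assumes "1 \<le> m" "m \<le> Suc r"
  shows "const_term (Ys t r m e 1) = const_term (Fs t r m e 1)"
  using assms(2,1)
proof (induction m arbitrary: e rule: inc_induct)
  case base
  then show ?case by (simp add: Ys_Suc_r Fs_Suc_r)
next
  case (step m)
  have m: "1 \<le> m" "m \<le> r" using step by auto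
  define N where "N e = nat (- Poly_Mapping.lookup e m)" for e :: "nat \<Rightarrow>\<^sub>0 int"
  show ?case
  proof (induction "N e" arbitrary: e rule: less_induct)
    case less
    consider "Poly_Mapping.lookup e m > 0" | "Poly_Mapping.lookup e m = 0" | "Poly_Mapping.lookup e m < 0"
      by linarith
    then show ?case
    proof cases
      case 1
      then have "Fs t r m e 1 = 0"
        using Fs_props[of m r t] m by (auto simp: cone_supported_def)
      then show ?thesis using 1 m by (simp add: const_term_Ys_pos)
    next
      case 2
      then show ?thesis
        using step.IH m by (simp add: const_term_Ys_0 Fs_step)
    next
      case 3
      let ?e = "\<lambda>l j. e + (Poly_Mapping.single m (int l) - Poly_Mapping.single j (int l))"
      have IH: "const_term (Ys t r m (?e l j) 1) = const_term (Fs t r m (?e l j) 1)"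
        if "odd l" "j \<in> {Suc m..r}" for l j
      proof (rule less)
        show "N (?e l j) < N e"
          using that 3 odd_pos[of l] by (simp add: N_def lookup_add lookup_minus lookup_single)
      qed
      have N: "- Poly_Mapping.lookup e m \<le> int (N e)" by (simp add: N_def)
      have "of_int (Poly_Mapping.lookup e m) * const_term (Ys t r m e 1) =
          (\<Sum>l | l \<le> N e \<and> odd l. \<Sum>j\<in>{Suc m..r}. gamma (t m) (t j) l * const_term (Fs t r m (?e l j) 1))"
        unfolding euler_Ys[OF m N]
        by (intro sum.cong refl) (simp add: IH add_diff_eq[symmetric])
      also have "\<dots> = const_term (scal (of_int (Poly_Mapping.lookup e m)) (Fs t r m e 1))"
        by (simp only: Fs_step(2)[OF m N] lookup_sum lookup_scal)
      finally have "of_int (Poly_Mapping.lookup e m) * const_term (Ys t r m e 1) =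
          of_int (Poly_Mapping.lookup e m) * const_term (Fs t r m e 1)"
        by (simp only: lookup_scal)
      then show ?thesis using 3 by simp
    qed
  qed
qed

text \<open>There are only finitely many exponents of total degree \<open>0\<close> below a given one, since the upper bounds
  on all but one entry give a lower bound on the remaining entry.\<close>

lemma finite_bounded_height:
  "finite {k. height r k = 0 \<and> (\<forall>l. l = 0 \<or> r < l \<longrightarrow> Poly_Mapping.lookup k l = 0) \<and>
     (\<forall>l. Poly_Mapping.lookup k l \<le> Poly_Mapping.lookup e l)}" (is "finite ?S")
proof -
  define b where "b = (\<Sum>l=1..r. \<bar>Poly_Mapping.lookup e l\<bar>)"
  have bounds: "Poly_Mapping.lookup k l \<in> {-b..b}" if "k \<in> ?S" "l \<in> {1..r}" for k l
  proof -
    have "Poly_Mapping.lookup e l \<le> b"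
    proof -
      have "\<bar>Poly_Mapping.lookup e l\<bar> \<le> b"
        unfolding b_def by (rule member_le_sum) (use that in auto)
      then show ?thesis by simp
    qed
    moreover have "(\<Sum>i\<in>{1..r} - {l}. Poly_Mapping.lookup k i) \<le> b"
    proof -
      have "(\<Sum>i\<in>{1..r} - {l}. Poly_Mapping.lookup k i) \<le> (\<Sum>i\<in>{1..r} - {l}. \<bar>Poly_Mapping.lookup e i\<bar>)"
      proof (rule sum_mono)
        fix i
        have "Poly_Mapping.lookup k i \<le> Poly_Mapping.lookup e i" using that(1) by blast
        then show "Poly_Mapping.lookup k i \<le> \<bar>Poly_Mapping.lookup e i\<bar>" by linarith
      qed
      also have "\<dots> \<le> b" unfolding b_def by (rule sum_mono2) auto
      finally show ?thesis .
    qed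
    moreover have "Poly_Mapping.lookup k l + (\<Sum>i\<in>{1..r} - {l}. Poly_Mapping.lookup k i) = 0"
      using that sum.remove[of "{1..r}" l "Poly_Mapping.lookup k"] by (simp add: height_def)
    moreover have "Poly_Mapping.lookup k l \<le> Poly_Mapping.lookup e l" using that(1) by blast
    ultimately show ?thesis by simp
  qed
  have "Poly_Mapping.lookup ` ?S \<subseteq> {f. \<forall>l. (l \<in> {1..r} \<longrightarrow> f l \<in> {-b..b}) \<and> (l \<notin> {1..r} \<longrightarrow> f l = 0)}"
  proof (clarify, intro conjI impI)
    fix k l assume k: "height r k = 0" "\<forall>l. l = 0 \<or> r < l \<longrightarrow> Poly_Mapping.lookup k l = 0"
      "\<forall>l. Poly_Mapping.lookup k l \<le> Poly_Mapping.lookup e l"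
    then have "k \<in> ?S" by blast
    then show "l \<in> {1..r} \<Longrightarrow> Poly_Mapping.lookup k l \<in> {-b..b}" by (rule bounds)
    show "l \<notin> {1..r} \<Longrightarrow> Poly_Mapping.lookup k l = 0"
      using k(2) by (metis atLeastAtMost_iff less_one linorder_not_less)
  qed
  then have "finite (Poly_Mapping.lookup ` ?S)"
    by (rule finite_subset) (intro finite_set_of_finite_funs; simp)
  then show ?thesis
    by (rule finite_imageD) (simp add: inj_on_def poly_mapping_eqI)
qed

theorem corollary3p2:
  fixes t :: "nat \<Rightarrow> 'a::field_char_0" and r :: nat
  assumes "\<And>i n. 1 \<le> i \<Longrightarrow> i \<le> r \<Longrightarrow> odd n \<Longrightarrow> t i ^ n \<noteq> 1"
  shows "op_prod [at_var i (Y_series (t i)). i \<leftarrow> [1..<Suc r]] =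
         op_times
           (op_prod [at_ratio j i (F_fps (t i) (t j)). i \<leftarrow> [1..<Suc r], j \<leftarrow> [Suc i..<Suc r]])
           (normal_Y r t)"
proof -
  let ?F = "Fs t r 1" and ?N = "normal_Y r t"
  have F: "scalar_series ?F" and cone: "cone_supported r 1 ?F"
    using Fs_props[of 1 r t] by auto
  \<comment> \<open>On the vacuum, the normally ordered product has only nonnegative powers of the \<open>z\<^sub>i\<close>.\<close>
  have comp: "composable ?F ?N"
  proof (rule composable_of_vacuum[where I = "{1..r}"])
    fix e
    have "{k. ?F k \<noteq> (\<lambda>_. 0) \<and> ?N (e - k) 1 \<noteq> 0} \<subseteq>
        {k. height r k = 0 \<and> (\<forall>l. l = 0 \<or> r < l \<longrightarrow> Poly_Mapping.lookup k l = 0) \<and>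
          (\<forall>l. Poly_Mapping.lookup k l \<le> Poly_Mapping.lookup e l)}"
    proof
      fix k assume k: "k \<in> {k. ?F k \<noteq> (\<lambda>_. 0) \<and> ?N (e - k) 1 \<noteq> 0}"
      then have "?F k 1 \<noteq> 0" using scalar_series_nonzero[OF F] by blast
      then have "height r k = 0 \<and> (\<forall>l. l = 0 \<or> r < l \<longrightarrow> Poly_Mapping.lookup k l = 0)"
        using cone by (auto simp: cone_supported_def)
      moreover have "Poly_Mapping.lookup k l \<le> Poly_Mapping.lookup e l" for l
        using normal_Y_1_support[of r t "e - k" l] k by (simp add: lookup_minus)
      ultimately show "k \<in> {k. height r k = 0 \<and> (\<forall>l. l = 0 \<or> r < l \<longrightarrow> Poly_Mapping.lookup k l = 0) \<and>
          (\<forall>l. Poly_Mapping.lookup k l \<le> Poly_Mapping.lookup e l)}" by blast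
    qed
    then show "finite {k. ?F k \<noteq> (\<lambda>_. 0) \<and> ?N (e - k) 1 \<noteq> 0}"
      using finite_bounded_height by (rule finite_subset)
  qed (auto simp: linear_normal_Y simp del: One_nat_def intro: pvar_normal_Y)
  have "Ys t r 1 = op_times ?F ?N"
  proof (rule op_series_eqI[where I = "{1..r}"])
    show "linear_op (Ys t r 1 e)" for e by (simp add: linear_Ys)
    show "linear_op (op_times ?F ?N e)" for e
      by (intro linear_op_times scalar_series_linear F linear_normal_Y comp)
    fix n :: nat assume n: "odd n"
    show "shift_comm (pdiff n) {1..r} (\<lambda>i. Poly_Mapping.single i (int n)) (\<lambda>i. alpha (t i) n) (Ys t r 1)"
      using n by (intro pdiff_Ys) simp_all
    show "shift_comm ((*) (pvar n)) {1..r} (\<lambda>i. Poly_Mapping.single i (- int n)) (\<lambda>i. beta (t i) n) (Ys t r 1)"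
      using n by (intro pvar_Ys) simp_all
    have "shift_comm (pdiff n) {1..r} (\<lambda>i. Poly_Mapping.single i (int n)) (\<lambda>i. 0 + alpha (t i) n) (op_times ?F ?N)"
      by (intro shift_comm_times linear_op_pdiff scalar_series_linear F linear_normal_Y comp
          scalar_series_shift_comm pdiff_normal_Y n) simp
    then show "shift_comm (pdiff n) {1..r} (\<lambda>i. Poly_Mapping.single i (int n)) (\<lambda>i. alpha (t i) n) (op_times ?F ?N)"
      by simp
    have "shift_comm ((*) (pvar n)) {1..r} (\<lambda>i. Poly_Mapping.single i (- int n)) (\<lambda>i. 0 + beta (t i) n) (op_times ?F ?N)"
      by (intro shift_comm_times linear_op_pvar scalar_series_linear F linear_normal_Y comp
          scalar_series_shift_comm pvar_normal_Y n) simp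
    then show "shift_comm ((*) (pvar n)) {1..r} (\<lambda>i. Poly_Mapping.single i (- int n)) (\<lambda>i. beta (t i) n) (op_times ?F ?N)"
      by simp
  next
    fix e
    let ?K = "insert e {k. ?F k \<noteq> (\<lambda>_. 0) \<and> ?N (e - k) 1 \<noteq> 0}"
    have fin: "finite ?K"
      by (intro finite.insertI comp[unfolded composable_def, rule_format])
    then have "op_times ?F ?N e 1 = (\<Sum>k\<in>?K. ?F k (?N (e - k) 1))"
      by (intro op_times_eq_sum scalar_series_linear F) auto
    then have "const_term (op_times ?F ?N e 1) =
        (\<Sum>k\<in>?K. const_term (?F k 1) * const_term (?N (e - k) 1))"
      by (simp only: lookup_sum scalar_series_const_term[OF F, of _ "?N _ 1"])
    also have "\<dots> = (\<Sum>k\<in>?K. if k = e then const_term (?F k 1) else 0)"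
      by (intro sum.cong refl) (auto simp: const_term_normal_Y_1)
    also have "\<dots> = const_term (?F e 1)" using fin by simp
    finally show "const_term (Ys t r 1 e 1) = const_term (op_times ?F ?N e 1)"
      by (simp add: const_term_Ys_eq_Fs)
  qed
  then show ?thesis by (simp only: Ys_def Fs_def)
qed

end
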